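(* Let $M$ be a monoid such that $\mathfrak{R}(K)$ is finite for every finitely generated submonoid $K$ of $M$. Furthermore, let $G=(N,T,M,P,S)$ be a valence grammar over $M$. Then $L(G)$ is context-free.
   Context: For a monoid $K$ (operation by juxtaposition, neutral element $1$), $\mathfrak{R}(K)=\{a\in K\mid\exists b\in K: ab=1\}$. Submonoids contain the neutral element of the ambient monoid. An alphabet is a finite set of symbols, and $X^*$ is the free monoid of words over $X$. A valence grammar over $M$ is a tuple $G=(N,T,M,P,S)$, where $N$ (nonterminals) and $T$ (terminals) are disjoint alphabets, $P\subseteq N\times(N\cup T)^*\times M$ is a finite set of productions (written $(A\to w;m)$), and $S\in N$ is the start symbol. The derivation relation on $(N\cup T)^*\times M$ is: $(u,a)\Rightarrow_G(v,b)$ iff there are $(A\to w;c)\in P$ and $r,s\in(N\cup T)^*$ with $u=rAs$, $v=rws$, $b=ac$. The generated language is $L(G)=\{w\in T^*\mid (S,1)\Rightarrow_G^*(w,1)\}$. Context-free languages are those generated by valence grammars over the trivial monoid (context-free grammars). *)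

theory Defs
  imports "HOL-Algebra.Elementary_Groups"
begin

definition right_invertibles :: "('m, 'b) monoid_scheme \<Rightarrow> 'm set" where
  "right_invertibles K =
     {a \<in> carrier K. \<exists>b \<in> carrier K. a \<otimes>\<^bsub>K\<^esub> b = \<one>\<^bsub>K\<^esub>}"

definition generated_submonoid :: "('m, 'b) monoid_scheme \<Rightarrow> 'm set \<Rightarrow> 'm set" where
  "generated_submonoid M F = \<Inter>{H. submonoid H M \<and> F \<subseteq> H}"

definition fin_gen_submonoid :: "'m set \<Rightarrow> ('m, 'b) monoid_scheme \<Rightarrow> bool" where
  "fin_gen_submonoid K M \<longleftrightarrow>
     (\<exists>F. finite F \<and> F \<subseteq> carrier M \<and> K = generated_submonoid M F)"

text \<open>
  Nonterminals and terminals are drawn from the two summands of \<open>'n + 't\<close>, so the two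
  alphabets are disjoint by construction. The monoid is not a field of the record; it is an
  argument of the notions below.
\<close>

record ('n, 't, 'm) valence_grammar =
  nonterminals :: "'n set"
  terminals :: "'t set"
  productions :: "('n \<times> ('n + 't) list \<times> 'm) set"
  start :: 'n

definition sentential_forms :: "('n, 't, 'm) valence_grammar \<Rightarrow> ('n + 't) list set" where
  "sentential_forms G = lists (nonterminals G <+> terminals G)"

definition valence_grammar_over ::
    "('m, 'b) monoid_scheme \<Rightarrow> ('n, 't, 'm) valence_grammar \<Rightarrow> bool" where
  "valence_grammar_over M G \<longleftrightarrow>
     finite (nonterminals G) \<and> finite (terminals G) \<and>
     finite (productions G) \<and>
     productions G \<subseteq> nonterminals G \<times> sentential_forms G \<times> carrier M \<and>
     start G \<in> nonterminals G"

definition derivation_step ::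
    "('m, 'b) monoid_scheme \<Rightarrow> ('n, 't, 'm) valence_grammar \<Rightarrow>
     ((('n + 't) list \<times> 'm) \<times> (('n + 't) list \<times> 'm)) set" where
  "derivation_step M G =
     {((u, a), (v, b)). a \<in> carrier M \<and> b \<in> carrier M \<and>
        (\<exists>A w c r s. (A, w, c) \<in> productions G \<and>
           r \<in> sentential_forms G \<and> s \<in> sentential_forms G \<and>
           u = r @ [Inl A] @ s \<and> v = r @ w @ s \<and> b = a \<otimes>\<^bsub>M\<^esub> c)}"

definition generated_language ::
    "('m, 'b) monoid_scheme \<Rightarrow> ('n, 't, 'm) valence_grammar \<Rightarrow> 't list set" where
  "generated_language M G =
     {w \<in> lists (terminals G).
        (([Inl (start G)], \<one>\<^bsub>M\<^esub>), (map Inr w, \<one>\<^bsub>M\<^esub>)) \<in> (derivation_step M G)\<^sup>*}"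

text \<open>
  The nonterminal alphabet is finite, so taking nonterminals from \<open>nat\<close> loses no generality;
  HOL cannot quantify existentially over the type of nonterminals.
\<close>

definition context_free :: "'t list set \<Rightarrow> bool" where
  "context_free L \<longleftrightarrow>
     (\<exists>G :: (nat, 't, unit) valence_grammar.
        valence_grammar_over (singleton_group ()) G \<and>
        L = generated_language (singleton_group ()) G)"

end

theory Submission
  imports Defs "HOL-Library.Tree" "HOL-Library.Sublist"
begin

text \<open>
  All prefix products of a label word with product \<open>1\<close> are right-invertible in the submonoid generated
  by the labels, and a finite monoid of right-invertible elements is a group. So only labels from a
  finite group \<open>H\<close> matter.

  A derivation is a tree of productions with a schedule, that is, a linear extension of the tree order.
  Fix a subtree \<open>s\<close> with more than \<open>2|H|\<^sup>3\<close> runs (maximal intervals of \<open>s\<close>-steps) in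
  the schedule. Among the starts of its runs, three agree in the product of all previous labels, of the
  previous labels inside \<open>s\<close>, and of those outside \<open>s\<close>. Between the first and the third of them all
  three products are \<open>1\<close>, so one may perform there all steps inside \<open>s\<close> before all steps outside
  without changing the product. This reduces the number of runs of \<open>s\<close>, and that of no other
  subtree grows. Hence some schedule with the same product gives every subtree at most
  \<open>2|H|\<^sup>3\<close> runs, and a context-free grammar can guess the products of the runs of each
  subtree and check locally that those of the children can be merged into those of the parent.
\<close>

section \<open>Label words of derivations\<close>

lemma shuffles_Cons_cases:
  assumes "z # zs \<in> shuffles xs ys"
  obtains (left) xs' where "xs = z # xs'" "zs \<in> shuffles xs' ys"
    | (right) ys' where "ys = z # ys'" "zs \<in> shuffles xs ys'"
  using assms by (auto elim: shufflesE)

text \<open>Each letter of \<open>zs\<close> comes from \<open>xs\<close>, \<open>us\<close> or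
  \<open>vs\<close>; \<open>ds\<close> keeps those from the first two in their order.\<close>

lemma shuffles_assoc:
  assumes "zs \<in> shuffles xs ys" "ys \<in> shuffles us vs"
  shows "\<exists>ds \<in> shuffles xs us. zs \<in> shuffles ds vs"
  using assms
proof (induction zs arbitrary: xs ys us vs)
  case Nil
  then show ?case by simp
next
  case (Cons z zs)
  from Cons.prems(1) show ?case
  proof (cases rule: shuffles_Cons_cases)
    case (left xs')
    then obtain ds where "ds \<in> shuffles xs' us" "zs \<in> shuffles ds vs"
      using Cons.IH Cons.prems(2) by blast
    then show ?thesis
      using left Cons_in_shuffles_leftI by metis
  next
    case (right ys')
    from Cons.prems(2)[unfolded right(1)] show ?thesis
    proof (cases rule: shuffles_Cons_cases)
      case (left us')
      then obtain ds where "ds \<in> shuffles xs us'" "zs \<in> shuffles ds vs"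
        using Cons.IH right by blast
      then show ?thesis
        using left Cons_in_shuffles_leftI Cons_in_shuffles_rightI by metis
    next
      case (right vs')
      then obtain ds where "ds \<in> shuffles xs us" "zs \<in> shuffles ds vs'"
        using Cons.IH \<open>zs \<in> shuffles xs ys'\<close> by blast
      then show ?thesis
        using right Cons_in_shuffles_rightI by metis
    qed
  qed
qed

lemma shuffles_append_left:
  "zs \<in> shuffles xs ys \<Longrightarrow> us @ zs \<in> shuffles (us @ xs) ys"
  by (induction us) (auto intro: Cons_in_shuffles_leftI)

lemma shuffles_append_right:
  "zs \<in> shuffles xs ys \<Longrightarrow> us @ zs \<in> shuffles xs (us @ ys)"
  by (induction us) (auto intro: Cons_in_shuffles_rightI)

text \<open>A letter of \<open>zs\<close> goes to the side that its image takes. Later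
  \<open>f\<close> maps nodes to labels, so that a split of a label word splits a schedule of
  nodes.\<close>

lemma map_in_shufflesE:
  assumes "map f zs \<in> shuffles xs ys"
  obtains xs' ys' where "zs \<in> shuffles xs' ys'" "map f xs' = xs" "map f ys' = ys"
proof -
  have "\<exists>xs' ys'. zs \<in> shuffles xs' ys' \<and> map f xs' = xs \<and> map f ys' = ys"
    using assms
  proof (induction zs arbitrary: xs ys)
    case Nil
    then show ?case by simp
  next
    case (Cons z zs)
    from Cons.prems have "f z # map f zs \<in> shuffles xs ys" by simp
    then show ?case
    proof (cases rule: shuffles_Cons_cases)
      case (left us)
      then obtain xs' ys' where "zs \<in> shuffles xs' ys'" "map f xs' = us" "map f ys' = ys"
        using Cons.IH by blast
      then have "z # zs \<in> shuffles (z # xs') ys'" "map f (z # xs') = xs"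
        using left by (auto intro: Cons_in_shuffles_leftI)
      then show ?thesis using \<open>map f ys' = ys\<close> by blast
    next
      case (right us)
      then obtain xs' ys' where "zs \<in> shuffles xs' ys'" "map f xs' = xs" "map f ys' = us"
        using Cons.IH by blast
      then have "z # zs \<in> shuffles xs' (z # ys')" "map f (z # ys') = ys"
        using right by (auto intro: Cons_in_shuffles_rightI)
      then show ?thesis using \<open>map f xs' = xs\<close> by blast
    qed
  qed
  then show ?thesis using that by blast
qed

section \<open>Products of words\<close>

definition word_prod :: "('m, 'b) monoid_scheme \<Rightarrow> 'm list \<Rightarrow> 'm" where
  "word_prod M xs = foldr (mult M) xs (one M)"

lemma word_prod_simps [simp]:
  "word_prod M [] = \<one>\<^bsub>M\<^esub>"
  "word_prod M (x # xs) = x \<otimes>\<^bsub>M\<^esub> word_prod M xs"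
  by (simp_all add: word_prod_def)

lemma word_prod_carrier_update [simp]:
  "word_prod (M\<lparr>carrier := K\<rparr>) xs = word_prod M xs"
  by (simp add: word_prod_def)

context monoid
begin

lemma word_prod_closed [simp, intro]:
  "set xs \<subseteq> carrier G \<Longrightarrow> word_prod G xs \<in> carrier G"
  by (induction xs) auto

lemma word_prod_append:
  "set xs \<subseteq> carrier G \<Longrightarrow> set ys \<subseteq> carrier G \<Longrightarrow>
    word_prod G (xs @ ys) = word_prod G xs \<otimes> word_prod G ys"
  by (induction xs) (auto simp: m_assoc)

lemma word_prod_concat:
  "(\<And>xs. xs \<in> set xss \<Longrightarrow> set xs \<subseteq> carrier G) \<Longrightarrow>
    word_prod G (concat xss) = word_prod G (map (word_prod G) xss)"
proof (induction xss)
  case (Cons xs xss)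
  then have "set (concat xss) \<subseteq> carrier G" "set xs \<subseteq> carrier G" by auto
  then have "word_prod G (xs @ concat xss) = word_prod G xs \<otimes> word_prod G (concat xss)"
    by (intro word_prod_append)
  then show ?case using Cons by simp
qed simp

end

text \<open>
  The label word of a derivation of a whole sentential form is an arbitrary interleaving of the
  label words of its symbols.
\<close>

inductive derives ::
    "('n \<times> ('n + 't) list \<times> 'm) set \<Rightarrow> ('n + 't) list \<Rightarrow> 'm list \<Rightarrow> 't list \<Rightarrow> bool"
  for P where
    Nil: "derives P [] [] []"
  | Terminal: "derives P u ws x \<Longrightarrow> derives P (Inr a # u) ws (a # x)"
  | Nonterminal: "\<lbrakk>(A, w, c) \<in> P; derives P w ws1 x1; derives P u ws2 x2;
      ws \<in> shuffles (c # ws1) ws2\<rbrakk> \<Longrightarrow> derives P (Inl A # u) ws (x1 @ x2)"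

inductive_cases derives_TerminalE: "derives P (Inr a # u) ws x"
inductive_cases derives_NonterminalE: "derives P (Inl A # u) ws x"

lemma derives_terminals: "derives P (map Inr x) [] x"
  by (induction x) (auto intro: derives.intros)

lemma derives_append:
  assumes "derives P u1 ws1 x1" "derives P u2 ws2 x2" "ws \<in> shuffles ws1 ws2"
  shows "derives P (u1 @ u2) ws (x1 @ x2)"
  using assms
proof (induction arbitrary: ws rule: derives.induct)
  case Nil
  then show ?case by simp
next
  case (Terminal u ws x a)
  then show ?case by (auto intro: derives.Terminal)
next
  case (Nonterminal A w c vs1 y1 u vs2 y2 vs)
  \<comment> \<open>\<open>shuffles_assoc\<close> regroups in one direction only; exchanging the
    arguments gives the other one, which keeps the label word of the head apart from the
    rest.\<close>
  have "ws \<in> shuffles ws2 vs" "vs \<in> shuffles vs2 (c # vs1)"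
    using Nonterminal.hyps Nonterminal.prems by (simp_all add: shuffles_commutes)
  then obtain ds where "ds \<in> shuffles ws2 vs2" "ws \<in> shuffles ds (c # vs1)"
    using shuffles_assoc by blast
  then have "ds \<in> shuffles vs2 ws2" "ws \<in> shuffles (c # vs1) ds"
    by (simp_all add: shuffles_commutes)
  then show ?case
    using derives.Nonterminal[OF Nonterminal.hyps(1,2)] Nonterminal.IH(2) Nonterminal.prems(1)
    by fastforce
qed

lemma derives_appendE:
  assumes "derives P (u1 @ u2) ws x"
  obtains ws1 ws2 x1 x2 where "derives P u1 ws1 x1" "derives P u2 ws2 x2"
    "ws \<in> shuffles ws1 ws2" "x = x1 @ x2"
proof -
  have "\<exists>ws1 ws2 x1 x2. derives P u1 ws1 x1 \<and> derives P u2 ws2 x2 \<and>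
      ws \<in> shuffles ws1 ws2 \<and> x = x1 @ x2"
    using assms
  proof (induction u1 arbitrary: ws x)
    case Nil
    have "ws \<in> shuffles [] ws" by simp
    then show ?case using derives.Nil Nil by fastforce
  next
    case (Cons X u1)
    show ?case
    proof (cases X)
      case (Inl A)
      with Cons.prems have "derives P (Inl A # (u1 @ u2)) ws x" by simp
      then obtain w c vs1 y1 vs2 y2 where *: "(A, w, c) \<in> P" "derives P w vs1 y1"
          "derives P (u1 @ u2) vs2 y2" "ws \<in> shuffles (c # vs1) vs2" "x = y1 @ y2"
        by (elim derives_NonterminalE) blast
      obtain ws1 ws2 x1 x2 where **: "derives P u1 ws1 x1" "derives P u2 ws2 x2"
          "vs2 \<in> shuffles ws1 ws2" "y2 = x1 @ x2"
        using Cons.IH[OF *(3)] by blast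
      obtain ds where ds: "ds \<in> shuffles (c # vs1) ws1" "ws \<in> shuffles ds ws2"
        using shuffles_assoc[OF *(4) **(3)] by blast
      have "derives P (Inl A # u1) ds (y1 @ x1)"
        using derives.Nonterminal[OF *(1,2) **(1) ds(1)] .
      then show ?thesis
        using Inl ds(2) *(5) **(2,4) by (metis append.assoc)
    next
      case (Inr a)
      with Cons.prems have "derives P (Inr a # (u1 @ u2)) ws x" by simp
      then obtain y where y: "derives P (u1 @ u2) ws y" "x = a # y"
        by (elim derives_TerminalE) blast
      obtain ws1 ws2 x1 x2 where *: "derives P u1 ws1 x1" "derives P u2 ws2 x2"
          "ws \<in> shuffles ws1 ws2" "y = x1 @ x2"
        using Cons.IH[OF y(1)] by (elim exE conjE)
      have "derives P (X # u1) ws1 (a # x1)" "x = (a # x1) @ x2"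
        using Inr derives.Terminal[OF *(1)] *(4) y(2) by simp_all
      then show ?thesis
        using *(2,3) by blast
    qed
  qed
  then show ?thesis using that by blast
qed

text \<open>Every use of a production puts its label into the word, so an empty word leaves only
  terminals.\<close>

lemma derives_Nil_iff: "derives P u [] x \<longleftrightarrow> u = map Inr x"
proof
  have "derives P u ws x \<Longrightarrow> ws = [] \<Longrightarrow> u = map Inr x" for ws
    by (induction rule: derives.induct) auto
  then show "derives P u [] x \<Longrightarrow> u = map Inr x" by blast
qed (simp add: derives_terminals)

lemma derives_step:
  assumes "(A, w, c) \<in> P" "derives P (r @ w @ s) ws x"
  shows "derives P (r @ [Inl A] @ s) (c # ws) x"
proof -
  obtain ws1 ws2 x1 x2 where 1: "derives P r ws1 x1" "derives P (w @ s) ws2 x2"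
      "ws \<in> shuffles ws1 ws2" "x = x1 @ x2"
    using derives_appendE[OF assms(2)] by metis
  obtain ws3 ws4 x3 x4 where 2: "derives P w ws3 x3" "derives P s ws4 x4"
      "ws2 \<in> shuffles ws3 ws4" "x2 = x3 @ x4"
    using derives_appendE[OF 1(2)] by metis
  have "derives P (Inl A # s) (c # ws2) (x3 @ x4)"
    using derives.Nonterminal[OF assms(1) 2(1,2)] 2(3) by (simp add: Cons_in_shuffles_leftI)
  then have "derives P (r @ Inl A # s) (c # ws) (x1 @ x3 @ x4)"
    using derives_append[OF 1(1)] 1(3) by (simp add: Cons_in_shuffles_rightI)
  then show ?thesis using 1(4) 2(4) by simp
qed

text \<open>In \<open>Nonterminal\<close> the label \<open>c\<close> precedes all of
  \<open>ws1\<close>, so the first label of the whole word belongs to a nonterminal of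
  \<open>u\<close> itself, which can be rewritten first.\<close>

lemma derives_ConsE:
  assumes "derives P u (c # ws) x"
  obtains r A w s where "u = r @ [Inl A] @ s" "(A, w, c) \<in> P" "derives P (r @ w @ s) ws x"
proof -
  have "\<exists>r A w s. u = r @ [Inl A] @ s \<and> (A, w, c) \<in> P \<and> derives P (r @ w @ s) ws x"
    if "derives P u vs x" "vs = c # ws" for u vs ws x
    using that
  proof (induction arbitrary: ws rule: derives.induct)
    case Nil
    then show ?case by simp
  next
    case (Terminal u vs x a)
    from Terminal.IH[OF Terminal.prems] obtain r A w s
      where *: "u = r @ [Inl A] @ s" "(A, w, c) \<in> P" "derives P (r @ w @ s) ws x"
      by (elim exE conjE)
    have "derives P ((Inr a # r) @ w @ s) ws (a # x)"
      using derives.Terminal[OF *(3)] by simp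
    moreover have "Inr a # u = (Inr a # r) @ [Inl A] @ s" using * by simp
    ultimately show ?case using *(2) by blast
  next
    case (Nonterminal A w d ws1 x1 u ws2 x2 vs)
    have "c # ws \<in> shuffles (d # ws1) ws2" using Nonterminal.hyps Nonterminal.prems by simp
    then show ?case
    proof (cases rule: shuffles_Cons_cases)
      case (left xs')
      then have "derives P ([] @ w @ u) ws (x1 @ x2)"
        using derives_append[OF Nonterminal.hyps(2,3)] by simp
      moreover have "Inl A # u = [] @ [Inl A] @ u" by simp
      ultimately show ?thesis using Nonterminal.hyps(1) left by blast
    next
      case (right ys')
      from Nonterminal.IH(2)[OF right(1)] obtain r B v s
        where *: "u = r @ [Inl B] @ s" "(B, v, c) \<in> P" "derives P (r @ v @ s) ys' x2"
        by (elim exE conjE)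
      have "derives P ((Inl A # r) @ v @ s) ws (x1 @ x2)"
        using derives.Nonterminal[OF Nonterminal.hyps(1,2) *(3) right(2)] by simp
      moreover have "Inl A # u = (Inl A # r) @ [Inl B] @ s" using * by simp
      ultimately show ?thesis using *(2) by blast
    qed
  qed
  then show ?thesis using that assms by blast
qed

lemma derives_labels: "derives P u ws x \<Longrightarrow> set ws \<subseteq> (snd \<circ> snd) ` P"
proof (induction rule: derives.induct)
  case (Nonterminal A w c ws1 x1 u ws2 x2 ws)
  have "set ws = set (c # ws1) \<union> set ws2"
    using Nonterminal.hyps by (intro set_shuffles)
  moreover have "c \<in> (snd \<circ> snd) ` P"
    using Nonterminal.hyps(1) by (force simp: image_iff)
  ultimately show ?case using Nonterminal.IH by auto
qed auto

text \<open>Serves later to drop the productions whose labels lie outside the finite group.\<close>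

lemma derives_restrict_labels:
  "derives P u ws x \<Longrightarrow> set ws \<subseteq> R \<Longrightarrow> derives {(A, w, c) \<in> P. c \<in> R} u ws x"
proof (induction rule: derives.induct)
  case (Nonterminal A w c ws1 x1 u ws2 x2 ws)
  have "set ws = set (c # ws1) \<union> set ws2"
    using Nonterminal.hyps by (intro set_shuffles)
  then have "set ws1 \<subseteq> R" "set ws2 \<subseteq> R" "c \<in> R" using Nonterminal.prems by auto
  then show ?case
    using derives.Nonterminal[OF _ Nonterminal.IH Nonterminal.hyps(4)] Nonterminal.hyps(1) by simp
qed (simp_all add: derives.Nil derives.Terminal)

lemma derives_mono: "derives P u ws x \<Longrightarrow> P \<subseteq> Q \<Longrightarrow> derives Q u ws x"
proof (induction rule: derives.induct)
  case (Nonterminal A w c ws1 x1 u ws2 x2 ws)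
  then have "(A, w, c) \<in> Q" by blast
  from derives.Nonterminal[OF this Nonterminal.IH[OF Nonterminal.prems] Nonterminal.hyps(4)]
  show ?case .
qed (simp_all add: derives.Nil derives.Terminal)

section \<open>Label words and the derivation relation\<close>

lemma derives_yield:
  assumes "derives P u ws x" "P \<subseteq> N \<times> lists (N <+> T) \<times> C" "u \<in> lists (N <+> T)"
  shows "x \<in> lists T"
  using assms by (induction rule: derives.induct) auto

text \<open>The letters of \<open>ws\<close> become the labels of successive steps, peeled off by
  \<open>derives_ConsE\<close>; the arbitrary \<open>a\<close> is the product collected so
  far.\<close>

lemma derivation_step_if_derives:
  assumes "monoid M" "valence_grammar_over M G" "derives (productions G) u ws x"
    "u \<in> sentential_forms G" "a \<in> carrier M"
  shows "((u, a), (map Inr x, a \<otimes>\<^bsub>M\<^esub> word_prod M ws)) \<in> (derivation_step M G)\<^sup>*"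
  using assms(3-)
proof (induction ws arbitrary: u a)
  case Nil
  then show ?case using assms(1) by (simp add: derives_Nil_iff monoid.r_one)
next
  case (Cons c ws)
  interpret monoid M by fact
  obtain r A w s where *: "u = r @ [Inl A] @ s" "(A, w, c) \<in> productions G"
      "derives (productions G) (r @ w @ s) ws x"
    using derives_ConsE[OF Cons.prems(1)] by metis
  have P: "productions G \<subseteq> nonterminals G \<times> sentential_forms G \<times> carrier M"
    using assms(2) by (simp add: valence_grammar_over_def)
  have sf: "r \<in> sentential_forms G" "s \<in> sentential_forms G" "w \<in> sentential_forms G"
      "c \<in> carrier M"
    using Cons.prems(2) * P by (auto simp: sentential_forms_def)
  have "set (c # ws) \<subseteq> carrier M"
    using derives_labels[OF Cons.prems(1)] P by fastforce
  then have eq: "a \<otimes>\<^bsub>M\<^esub> c \<otimes>\<^bsub>M\<^esub> word_prod M ws = a \<otimes>\<^bsub>M\<^esub> word_prod M (c # ws)"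
    using Cons.prems(3) by (simp add: m_assoc)
  have "((u, a), (r @ w @ s, a \<otimes>\<^bsub>M\<^esub> c)) \<in> derivation_step M G"
    unfolding derivation_step_def using * sf Cons.prems(3) by fast
  moreover have "((r @ w @ s, a \<otimes>\<^bsub>M\<^esub> c), (map Inr x, a \<otimes>\<^bsub>M\<^esub> c \<otimes>\<^bsub>M\<^esub> word_prod M ws))
      \<in> (derivation_step M G)\<^sup>*"
    using sf Cons.prems(3) by (intro Cons.IH[OF *(3)]) (auto simp: sentential_forms_def)
  ultimately show ?case unfolding eq by (rule converse_rtrancl_into_rtrancl)
qed

lemma derives_if_derivation_steps:
  assumes "monoid M" "valence_grammar_over M G"
    "((u, a), (map Inr x, b)) \<in> (derivation_step M G)\<^sup>*" "a \<in> carrier M"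
  shows "\<exists>ws. derives (productions G) u ws x \<and> b = a \<otimes>\<^bsub>M\<^esub> word_prod M ws"
  using assms(3-)
proof (induction "(u, a)" arbitrary: u a rule: converse_rtrancl_induct)
  case base
  then show ?case
    using assms(1) derives_terminals monoid.r_one by (metis word_prod_simps(1))
next
  case (step z)
  interpret monoid M by fact
  obtain A w c r s where *: "(A, w, c) \<in> productions G" "u = r @ [Inl A] @ s"
      "z = (r @ w @ s, a \<otimes>\<^bsub>M\<^esub> c)"
    using step.hyps(1) by (auto simp: derivation_step_def)
  have P: "productions G \<subseteq> nonterminals G \<times> sentential_forms G \<times> carrier M"
    using assms(2) by (simp add: valence_grammar_over_def)
  then have "c \<in> carrier M" using * by auto
  then obtain ws where ws: "derives (productions G) (r @ w @ s) ws x"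
      "b = a \<otimes>\<^bsub>M\<^esub> c \<otimes>\<^bsub>M\<^esub> word_prod M ws"
    using step.hyps(3)[OF *(3)] step.prems by blast
  have "set ws \<subseteq> carrier M"
    using derives_labels[OF ws(1)] P by fastforce
  then have "b = a \<otimes>\<^bsub>M\<^esub> word_prod M (c # ws)"
    using ws(2) \<open>c \<in> carrier M\<close> step.prems by (simp add: m_assoc)
  moreover have "derives (productions G) u (c # ws) x"
    using derives_step[OF *(1) ws(1)] *(2) by simp
  ultimately show ?case by blast
qed

text \<open>Replaces the step relation by label words for the rest of the proof. That
  \<open>x\<close> consists of terminals of \<open>G\<close> follows from the shape of the
  productions by \<open>derives_yield\<close>.\<close>

lemma generated_language_eq:
  assumes "monoid M" "valence_grammar_over M G"
  shows "generated_language M G =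
    {x. \<exists>ws. derives (productions G) [Inl (start G)] ws x \<and> word_prod M ws = \<one>\<^bsub>M\<^esub>}"
proof (intro Set.set_eqI iffI)
  interpret monoid M by fact
  fix x
  assume "x \<in> generated_language M G"
  then have "(([Inl (start G)], \<one>\<^bsub>M\<^esub>), (map Inr x, \<one>\<^bsub>M\<^esub>)) \<in> (derivation_step M G)\<^sup>*"
    by (simp add: generated_language_def)
  then obtain ws where ws: "derives (productions G) [Inl (start G)] ws x"
      "\<one>\<^bsub>M\<^esub> = \<one>\<^bsub>M\<^esub> \<otimes>\<^bsub>M\<^esub> word_prod M ws"
    using derives_if_derivation_steps[OF assms] by blast
  moreover have "set ws \<subseteq> carrier M"
    using derives_labels[OF ws(1)] assms(2) by (fastforce simp: valence_grammar_over_def)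
  ultimately show "x \<in> {x. \<exists>ws. derives (productions G) [Inl (start G)] ws x \<and> word_prod M ws = \<one>\<^bsub>M\<^esub>}"
    by auto
next
  interpret monoid M by fact
  fix x
  assume "x \<in> {x. \<exists>ws. derives (productions G) [Inl (start G)] ws x \<and> word_prod M ws = \<one>\<^bsub>M\<^esub>}"
  then obtain ws where ws: "derives (productions G) [Inl (start G)] ws x" "word_prod M ws = \<one>\<^bsub>M\<^esub>"
    by blast
  have start: "[Inl (start G)] \<in> sentential_forms G"
    using assms(2) by (auto simp: valence_grammar_over_def sentential_forms_def)
  have "(([Inl (start G)], \<one>\<^bsub>M\<^esub>), (map Inr x, \<one>\<^bsub>M\<^esub>)) \<in> (derivation_step M G)\<^sup>*"
    using derivation_step_if_derives[OF assms ws(1) start, of "\<one>\<^bsub>M\<^esub>"] ws(2) by simp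
  moreover have "x \<in> lists (terminals G)"
    using derives_yield[OF ws(1)] start assms(2)
    unfolding valence_grammar_over_def sentential_forms_def by blast
  ultimately show "x \<in> generated_language M G"
    by (simp add: generated_language_def)
qed

section \<open>Runs in a schedule\<close>

text \<open>The flag tells whether the preceding entry lies in \<open>s\<close>.\<close>

fun runs :: "'i set \<Rightarrow> bool \<Rightarrow> 'i list \<Rightarrow> nat" where
  "runs s b [] = 0"
| "runs s b (x # xs) = (if x \<in> s \<and> \<not> b then 1 else 0) + runs s (x \<in> s) xs"

lemma runs_append:
  "runs s b (xs @ ys) = runs s b xs + runs s (if xs = [] then b else last xs \<in> s) ys"
  by (induction xs arbitrary: b) auto

lemma runs_le_Suc_True: "runs s b xs \<le> Suc (runs s True xs)"
  by (cases xs) auto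

lemma runs_le_False: "runs s b xs \<le> runs s False xs"
  by (cases xs) auto

text \<open>Deleting an entry outside \<open>s\<close> can only fuse runs, and deleting one of
  \<open>s\<close> at worst moves the start of its run to the next entry. The tail \<open>zs\<close>
  allows for a continuation.\<close>

lemma runs_filter_le: "runs s b (filter P xs @ zs) \<le> runs s b (xs @ zs)"
proof (induction xs arbitrary: b)
  case (Cons x xs)
  have "runs s b (filter P xs @ zs) \<le> runs s b ((x # xs) @ zs)"
  proof (cases "x \<in> s")
    case True
    have "runs s b (filter P xs @ zs) \<le> (if b then 0 else 1) + runs s True (filter P xs @ zs)"
      using runs_le_Suc_True[of s b "filter P xs @ zs"] by (cases b) auto
    also have "\<dots> \<le> (if b then 0 else 1) + runs s True (xs @ zs)"
      using Cons.IH[of True] by simp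
    finally show ?thesis using True by (cases b) simp_all
  next
    case False
    have "runs s b (filter P xs @ zs) \<le> runs s False (xs @ zs)"
      using runs_le_False Cons.IH order_trans by blast
    then show ?thesis using False by simp
  qed
  then show ?case using Cons.IH[of "x \<in> s"] by (cases "P x") simp_all
qed simp

lemma runs_disjoint: "set xs \<inter> s = {} \<Longrightarrow> runs s b xs = 0"
  by (induction xs arbitrary: b) auto

lemma runs_subset: "set xs \<subseteq> s \<Longrightarrow> runs s b xs \<le> (if b then 0 else 1)"
proof (induction xs arbitrary: b)
  case (Cons x xs)
  then show ?case using Cons.IH[of True] by auto
qed simp

definition run_starts :: "'i set \<Rightarrow> 'i list \<Rightarrow> nat set" where
  "run_starts s xs = {k. k < length xs \<and> xs ! k \<in> s \<and> (k = 0 \<or> xs ! (k - 1) \<notin> s)}"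

lemma finite_run_starts [simp, intro]: "finite (run_starts s xs)"
  by (simp add: run_starts_def)

lemma run_starts_snoc:
  "run_starts s (xs @ [x]) = run_starts s xs \<union>
    (if x \<in> s \<and> (xs = [] \<or> last xs \<notin> s) then {length xs} else {})"
proof -
  have "k \<in> run_starts s (xs @ [x]) \<longleftrightarrow> k \<in> run_starts s xs \<or>
      k = length xs \<and> x \<in> s \<and> (xs = [] \<or> last xs \<notin> s)" for k
  proof (cases "k < length xs")
    case True
    then have "(xs @ [x]) ! (k - 1) = xs ! (k - 1)" by (simp add: nth_append less_imp_diff_less)
    then show ?thesis using True by (auto simp: run_starts_def nth_append)
  next
    case False
    then show ?thesis
      by (cases "xs = []") (auto simp: run_starts_def nth_append last_conv_nth less_Suc_eq)
  qed
  then show ?thesis by auto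
qed

text \<open>Links the recursive count, suited to induction, with a set of positions, to which the
  pigeonhole principle applies.\<close>

lemma card_run_starts: "card (run_starts s xs) = runs s False xs"
proof (induction xs rule: rev_induct)
  case Nil
  then show ?case by (simp add: run_starts_def)
next
  case (snoc x xs)
  have "length xs \<notin> run_starts s xs" by (simp add: run_starts_def)
  then show ?case using snoc by (auto simp: run_starts_snoc runs_append)
qed

section \<open>Unshuffling a segment\<close>

definition unshuffle :: "'i set \<Rightarrow> 'i list \<Rightarrow> 'i list" where
  "unshuffle s xs = filter (\<lambda>x. x \<in> s) xs @ filter (\<lambda>x. x \<notin> s) xs"

lemma set_unshuffle [simp]: "set (unshuffle s xs) = set xs"
  by (auto simp: unshuffle_def)

lemma distinct_unshuffle [simp]: "distinct (unshuffle s xs) \<longleftrightarrow> distinct xs"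
proof (induction xs)
  case (Cons x xs)
  then show ?case by (auto simp: unshuffle_def)
qed (simp add: unshuffle_def)

text \<open>Unshuffling is stable on either side of \<open>s\<close>, so order constraints among
  entries of one side survive.\<close>

lemma filter_unshuffle:
  assumes "t \<subseteq> s \<or> t \<inter> s = {}"
  shows "filter (\<lambda>x. x \<in> t) (unshuffle s xs) = filter (\<lambda>x. x \<in> t) xs"
  using assms
proof
  assume "t \<subseteq> s"
  then have "x \<in> s \<and> x \<in> t \<longleftrightarrow> x \<in> t" "\<not> (x \<notin> s \<and> x \<in> t)" for x by auto
  then show ?thesis by (simp add: unshuffle_def)
next
  assume "t \<inter> s = {}"
  then have "x \<notin> s \<and> x \<in> t \<longleftrightarrow> x \<in> t" "\<not> (x \<in> s \<and> x \<in> t)" for x by auto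
  then show ?thesis by (simp add: unshuffle_def)
qed

text \<open>
  The segment and its continuation both start at the beginning of a run of \<open>s\<close>; hence no set that is
  nested with \<open>s\<close> or disjoint from it gains a run when the segment is unshuffled.
\<close>

lemma runs_unshuffle_le:
  assumes "t \<subseteq> s \<or> s \<subseteq> t \<or> t \<inter> s = {}"
    and "a = [] \<or> last a \<notin> s" "b \<noteq> []" "hd b \<in> s" "last b \<notin> s" "c \<noteq> []" "hd c \<in> s"
  shows "runs t False (a @ unshuffle s b @ c) \<le> runs t False (a @ b @ c)"
proof -
  let ?bs = "filter (\<lambda>x. x \<in> s) b" and ?bo = "filter (\<lambda>x. x \<notin> s) b"
  obtain x b' where b: "b = x # b'" "x \<in> s" using assms by (cases b) auto
  obtain z c' where c: "c = z # c'" "z \<in> s" using assms by (cases c) auto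
  have bs: "?bs \<noteq> []" using b by simp
  have bo: "?bo \<noteq> []" "last ?bo = last b"
    using assms(3,5) by (induction b) (auto split: if_splits)
  have last_bs: "last ?bs \<in> s" using bs last_in_set by fastforce
  \<comment> \<open>The flag left by \<open>a\<close>; with it \<open>runs_append\<close> reduces
    the claim to the part after \<open>a\<close>.\<close>
  define q where "q = (if a = [] then False else last a \<in> t)"
  have "runs t q (unshuffle s b @ c) \<le> runs t q (b @ c)"
    using assms(1)
  proof (elim disjE)
    \<comment> \<open>All entries of \<open>t\<close> are in the front half, and the segment ends
      outside \<open>t\<close> before and after unshuffling, so \<open>c\<close> is entered with the
      same flag.\<close>
    assume t: "t \<subseteq> s"
    then have nl: "last b \<notin> t" using assms by auto
    have "runs t q (unshuffle s b @ c) = runs t q ?bs + runs t False c"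
      using bs bo nl t runs_disjoint[of ?bo t]
      by (auto simp: unshuffle_def runs_append)
    also have "\<dots> \<le> runs t q b + runs t False c"
      using runs_filter_le[of t q _ b "[]"] by simp
    finally show ?thesis using nl assms(3) by (simp add: runs_append)
  next
    assume t: "t \<inter> s = {}"
    have "x \<notin> t" using b t by auto
    have "runs t q ?bs = 0" "last ?bs \<notin> t"
      using last_bs t by (auto intro!: runs_disjoint)
    then have "runs t q (unshuffle s b @ c) = runs t False (?bo @ c)"
      using bs by (simp add: unshuffle_def runs_append)
    also have "\<dots> \<le> runs t False (b @ c)" by (rule runs_filter_le)
    finally show ?thesis using b \<open>x \<notin> t\<close> by simp
  next
    assume t: "s \<subseteq> t"
    have "x \<in> t" using b t by auto
    \<comment> \<open>After \<open>x\<close> the flag is set, and the entries of \<open>s\<close>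
      brought to the front keep it set, so they start no run of \<open>t\<close>.\<close>
    have skip: "runs t True (filter (\<lambda>x. x \<in> s) b' @ zs) = runs t True zs" for zs
    proof -
      have *: "set (filter (\<lambda>x. x \<in> s) b') \<subseteq> t" using t by auto
      then have "runs t True (filter (\<lambda>x. x \<in> s) b') = 0" using runs_subset[OF *, of True] by simp
      moreover have "filter (\<lambda>x. x \<in> s) b' \<noteq> [] \<Longrightarrow> last (filter (\<lambda>x. x \<in> s) b') \<in> t"
        using * last_in_set by blast
      ultimately show ?thesis by (simp add: runs_append)
    qed
    have "runs t q (unshuffle s b @ c) = (if q then 0 else 1) + runs t True (filter (\<lambda>x. x \<in> s) b' @ ?bo @ c)"
      using \<open>x \<in> t\<close> b by (simp add: unshuffle_def)
    also have "runs t True (filter (\<lambda>x. x \<in> s) b' @ ?bo @ c) = runs t True (?bo @ c)"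
      by (rule skip)
    also have "\<dots> \<le> runs t True (b @ c)" by (rule runs_filter_le)
    finally show ?thesis using \<open>x \<in> t\<close> b by (cases q) simp_all
  qed
  then show ?thesis by (simp add: runs_append q_def)
qed

text \<open>The heads of \<open>b1\<close> and \<open>b2\<close> start two runs, of which
  unshuffling leaves one. Before and after, the segment ends outside \<open>s\<close>, so
  \<open>c\<close> starts a new run.\<close>

lemma runs_unshuffle_less:
  assumes "a = [] \<or> last a \<notin> s" "b1 \<noteq> []" "b2 \<noteq> []" "hd b1 \<in> s" "hd b2 \<in> s"
    "last b1 \<notin> s" "last b2 \<notin> s" "hd c \<in> s" "c \<noteq> []"
  shows "runs s False (a @ unshuffle s (b1 @ b2) @ c) < runs s False (a @ (b1 @ b2) @ c)"
proof -
  let ?b = "b1 @ b2"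
  let ?bs = "filter (\<lambda>x. x \<in> s) ?b" and ?bo = "filter (\<lambda>x. x \<notin> s) ?b"
  have *: "\<exists>y \<in> set b2. y \<notin> s" using assms(3,7) last_in_set by blast
  have bo: "?bo \<noteq> []" using * by (auto simp: filter_empty_conv)
  then have "last ?bo \<notin> s" using last_in_set[of ?bo] by auto
  then have "runs s False (unshuffle s ?b @ c) = runs s False ?bs + runs s False c"
    using runs_disjoint[of ?bo s] bo by (auto simp: unshuffle_def runs_append simp del: filter_append)
  moreover have "runs s False ?bs \<le> 1" using runs_subset[of ?bs s False] by auto
  moreover have "runs s False (?b @ c) \<ge> 2 + runs s False c"
    using assms by (cases b1; cases b2) (auto simp: runs_append)
  ultimately have "runs s False (unshuffle s ?b @ c) < runs s False (?b @ c)" by simp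
  moreover have "(if a = [] then False else last a \<in> s) = False" using assms by auto
  ultimately show ?thesis by (simp only: runs_append)
qed

section \<open>Schedules with few runs\<close>

lemma exists_three_of_card:
  fixes A :: "nat set"
  assumes "finite A" "card A \<ge> 3"
  obtains i j k where "i \<in> A" "j \<in> A" "k \<in> A" "i < j" "j < k"
proof -
  obtain i j k where "i \<in> A" "j \<in> A" "k \<in> A" "i \<noteq> j" "i \<noteq> k" "j \<noteq> k"
    using assms card_le_Suc_iff[of 2 A] by (auto simp: numeral_eq_Suc card_le_Suc_iff)
  then show ?thesis using that by (metis linorder_neqE_nat)
qed

context group
begin

text \<open>Three agreeing starts are sought rather than two, because a segment between two could
  hold a single run, and unshuffling it would gain nothing.\<close>

lemma unshuffle_segment_exists:
  assumes fin: "finite (carrier G)" and f: "f ` set xs \<subseteq> carrier G"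
    and many: "runs s False xs > 2 * card (carrier G) ^ 3"
  obtains a b1 b2 c where "xs = a @ (b1 @ b2) @ c" "a = [] \<or> last a \<notin> s"
    "b1 \<noteq> []" "b2 \<noteq> []" "c \<noteq> []" "hd b1 \<in> s" "hd b2 \<in> s" "hd c \<in> s"
    "last b1 \<notin> s" "last b2 \<notin> s"
    "word_prod G (map f (unshuffle s (b1 @ b2))) = word_prod G (map f (b1 @ b2))"
proof -
  let ?w = "\<lambda>ys. word_prod G (map f ys)"
  let ?I = "filter (\<lambda>x. x \<in> s)" and ?O = "filter (\<lambda>x. x \<notin> s)"
  \<comment> \<open>\<open>st\<close> takes at most \<open>card (carrier G) ^ 3\<close> values, so
    more than twice as many run starts give some value at least three times.\<close>
  define st where "st k = (?w (take k xs), ?w (?I (take k xs)), ?w (?O (take k xs)))" for k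
  let ?C = "carrier G \<times> carrier G \<times> carrier G"
  have closed: "?w ys \<in> carrier G" if "set ys \<subseteq> set xs" for ys
    using f that by (intro word_prod_closed) auto
  have mult: "?w (ys @ zs) = ?w ys \<otimes> ?w zs" if "set ys \<subseteq> set xs" "set zs \<subseteq> set xs" for ys zs
  proof -
    have "set (map f ys) \<subseteq> carrier G" "set (map f zs) \<subseteq> carrier G" using f that by auto
    then show ?thesis by (simp add: word_prod_append)
  qed
  have tk: "set (take k xs) \<subseteq> set xs" for k by (rule set_take_subset)
  have "st k \<in> ?C" for k
    unfolding st_def using tk[of k] by (intro SigmaI closed) auto
  then have "st \<in> run_starts s xs \<rightarrow> ?C" by blast
  moreover have "finite ?C" "?C \<noteq> {}" using fin by auto
  ultimately obtain y where y: "card (run_starts s xs) \<le> card (st -` {y} \<inter> run_starts s xs) * card ?C"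
    using pigeonhole_card[of st "run_starts s xs" ?C] by auto
  have "card ?C = card (carrier G) ^ 3"
    by (simp add: card_cartesian_product power3_eq_cube)
  then have "2 * card ?C < card (st -` {y} \<inter> run_starts s xs) * card ?C"
    using y many unfolding card_run_starts by linarith
  then have "card (st -` {y} \<inter> run_starts s xs) \<ge> 3"
    unfolding mult_less_cancel2 by linarith
  then obtain i j k where ijk: "i < j" "j < k" "st i = st k"
      "i \<in> run_starts s xs" "j \<in> run_starts s xs" "k \<in> run_starts s xs"
    using exists_three_of_card[of "st -` {y} \<inter> run_starts s xs"] by (metis (no_types, lifting)
      IntD1 IntD2 finite_Int finite_run_starts singletonD vimageE)
  define a where "a = take i xs"
  define b1 where "b1 = drop i (take j xs)"
  define b2 where "b2 = drop j (take k xs)"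
  define c where "c = drop k xs"
  have len: "k < length xs" using ijk by (simp add: run_starts_def)
  have "take i (take j xs) = take i xs" "take j (take k xs) = take j xs"
    using ijk(1,2) by (simp_all add: min_def)
  then have ij: "take j xs = a @ b1" and "take k xs = take j xs @ b2"
    using append_take_drop_id[of i "take j xs"] append_take_drop_id[of j "take k xs"]
    by (simp_all only: a_def b1_def b2_def)
  then have jk: "take k xs = a @ b1 @ b2" by simp
  have xs: "xs = a @ (b1 @ b2) @ c"
    using jk append_take_drop_id[of k xs] by (simp add: c_def)
  \<comment> \<open>A run start is preceded by an entry outside \<open>s\<close>, or by nothing if
    it is \<open>0\<close>.\<close>
  have 1: "a = [] \<or> last a \<notin> s"
    using ijk len by (auto simp: a_def run_starts_def last_conv_nth min_def)
  have 2: "b1 \<noteq> []" "b2 \<noteq> []" "c \<noteq> []" using ijk len by (auto simp: b1_def b2_def c_def)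
  have 3: "hd b1 \<in> s" "hd b2 \<in> s" "hd c \<in> s"
    using ijk len by (auto simp: b1_def b2_def c_def hd_drop_conv_nth run_starts_def)
  have 4: "last b1 \<notin> s" "last b2 \<notin> s"
    using ijk len 2 by (auto simp: b1_def b2_def run_starts_def last_conv_nth)
  let ?b = "b1 @ b2"
  have sub: "set a \<subseteq> set xs" "set ?b \<subseteq> set xs" using xs by auto
  then have subs: "set (?I a) \<subseteq> set xs" "set (?I ?b) \<subseteq> set xs" "set (?O a) \<subseteq> set xs" "set (?O ?b) \<subseteq> set xs"
    by auto
  \<comment> \<open>Equal states at \<open>i\<close> and \<open>k\<close> let all three products
    over the segment cancel to \<open>\<one>\<close>, hence also that of its unshuffled
    form.\<close>
  have "?w a = ?w (a @ ?b)" "?w (?I a) = ?w (?I a @ ?I ?b)" "?w (?O a) = ?w (?O a @ ?O ?b)"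
    using ijk(3) jk by (simp_all add: st_def a_def)
  then have "?w ?b = \<one>" "?w (?I ?b) = \<one>" "?w (?O ?b) = \<one>"
    unfolding mult[OF sub] mult[OF subs(1,2)] mult[OF subs(3,4)]
    using closed[OF sub(1)] closed[OF sub(2)] closed[OF subs(1)] closed[OF subs(2)]
      closed[OF subs(3)] closed[OF subs(4)]
    by (simp_all only: l_cancel_one')
  then have "?w (unshuffle s ?b) = ?w ?b"
    using mult[OF subs(2,4)] by (simp add: unshuffle_def del: filter_append)
  then show ?thesis using that xs 1 2 3 4 by blast
qed

text \<open>\<open>(i, L) \<in> Q\<close> demands that \<open>i\<close> be scheduled before all of \<open>L\<close>.\<close>

lemma bounded_runs_exists:
  assumes fin: "finite (carrier G)" and f: "f ` set xs \<subseteq> carrier G"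
    and \<S>: "finite \<S>" "\<And>s t. s \<in> \<S> \<Longrightarrow> t \<in> \<S> \<Longrightarrow> t \<subseteq> s \<or> s \<subseteq> t \<or> t \<inter> s = {}"
    and Q: "\<And>s i L. s \<in> \<S> \<Longrightarrow> (i, L) \<in> Q \<Longrightarrow>
      insert i L \<subseteq> s \<or> insert i L \<inter> s = {} \<or> s \<subseteq> L \<and> i \<notin> L"
    and xs: "distinct xs" "\<And>i L. (i, L) \<in> Q \<Longrightarrow>
      filter (\<lambda>x. x \<in> insert i L) xs = i # filter (\<lambda>x. x \<in> L) xs"
  shows "\<exists>ys. distinct ys \<and> set ys = set xs \<and>
    word_prod G (map f ys) = word_prod G (map f xs) \<and>
    (\<forall>(i, L) \<in> Q. filter (\<lambda>x. x \<in> insert i L) ys = i # filter (\<lambda>x. x \<in> L) ys) \<and>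
    (\<forall>s \<in> \<S>. runs s False ys \<le> 2 * card (carrier G) ^ 3)"
  using f xs
\<comment> \<open>The total number of runs over \<open>\<S>\<close> drops: \<open>s\<close> loses a
  run and no other set gains one.\<close>
proof (induction "\<Sum>s\<in>\<S>. runs s False xs" arbitrary: xs rule: less_induct)
  case less
  show ?case
  proof (cases "\<forall>s \<in> \<S>. runs s False xs \<le> 2 * card (carrier G) ^ 3")
    case True
    then show ?thesis using less.prems by blast
  next
    case False
    then obtain s where s: "s \<in> \<S>" "runs s False xs > 2 * card (carrier G) ^ 3" by auto
    obtain a b1 b2 c where b: "xs = a @ (b1 @ b2) @ c" "a = [] \<or> last a \<notin> s"
      "b1 \<noteq> []" "b2 \<noteq> []" "c \<noteq> []" "hd b1 \<in> s" "hd b2 \<in> s" "hd c \<in> s"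
      "last b1 \<notin> s" "last b2 \<notin> s"
      "word_prod G (map f (unshuffle s (b1 @ b2))) = word_prod G (map f (b1 @ b2))"
      using unshuffle_segment_exists[OF fin less.prems(1) s(2)] by metis
    let ?b = "b1 @ b2"
    let ?ys = "a @ unshuffle s ?b @ c"
    have le: "runs t False ?ys \<le> runs t False xs" if "t \<in> \<S>" for t
      using runs_unshuffle_le[of t s a ?b c] \<S>(2)[OF s(1) that] b by simp
    have lt: "runs s False ?ys < runs s False xs"
      using runs_unshuffle_less[of a s b1 b2 c] b by simp
    have sum: "(\<Sum>s\<in>\<S>. runs s False ?ys) < (\<Sum>s\<in>\<S>. runs s False xs)"
      using le lt s(1) \<S>(1) by (intro sum_strict_mono_ex1) auto
    have set_ys: "set ?ys = set xs" using b(1) by auto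
    have dist: "distinct ?ys" using less.prems(2) b(1) by auto
    have sub: "set (map f a) \<subseteq> carrier G" "set (map f ?b) \<subseteq> carrier G"
        "set (map f (unshuffle s ?b)) \<subseteq> carrier G" "set (map f c) \<subseteq> carrier G"
      using less.prems(1) b(1) by auto
    have prod: "word_prod G (map f ?ys) = word_prod G (map f xs)"
    proof -
      have bc: "set (map f ?b @ map f c) \<subseteq> carrier G"
          "set (map f (unshuffle s ?b) @ map f c) \<subseteq> carrier G" using sub by auto
      have "word_prod G (map f ?ys) = word_prod G (map f a) \<otimes>
          (word_prod G (map f (unshuffle s ?b)) \<otimes> word_prod G (map f c))"
        using word_prod_append[OF sub(1) bc(2)] word_prod_append[OF sub(3,4)] by simp
      also have "\<dots> = word_prod G (map f a @ (map f ?b @ map f c))"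
        unfolding b(11) using word_prod_append[OF sub(1) bc(1)] word_prod_append[OF sub(2,4)] by simp
      finally show ?thesis using b(1) by simp
    qed
    have order: "filter (\<lambda>x. x \<in> insert i L) ?ys = i # filter (\<lambda>x. x \<in> L) ?ys"
      if iL: "(i, L) \<in> Q" for i L
    proof -
      have ord: "filter (\<lambda>x. x \<in> insert i L) xs = i # filter (\<lambda>x. x \<in> L) xs"
        using less.prems(3)[OF iL] .
      from Q[OF s(1) iL] show ?thesis
      proof (elim disjE)
        assume "insert i L \<subseteq> s"
        then have "filter (\<lambda>x. x \<in> insert i L) ?ys = filter (\<lambda>x. x \<in> insert i L) xs"
            "filter (\<lambda>x. x \<in> L) ?ys = filter (\<lambda>x. x \<in> L) xs"
          using filter_unshuffle[of "insert i L" s ?b] filter_unshuffle[of L s ?b] b(1) by auto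
        then show ?thesis using ord by simp
      next
        assume "insert i L \<inter> s = {}"
        then have "filter (\<lambda>x. x \<in> insert i L) ?ys = filter (\<lambda>x. x \<in> insert i L) xs"
            "filter (\<lambda>x. x \<in> L) ?ys = filter (\<lambda>x. x \<in> L) xs"
          using filter_unshuffle[of "insert i L" s ?b] filter_unshuffle[of L s ?b] b(1) by auto
        then show ?thesis using ord by simp
      next
        \<comment> \<open>The segment starts with an entry of \<open>s\<close>, hence of
          \<open>L\<close>. So \<open>i\<close>, the first entry of \<open>insert i L\<close>, lies
          before the segment, which may then be permuted freely.\<close>
        assume *: "s \<subseteq> L \<and> i \<notin> L"
        let ?F = "filter (\<lambda>x. x \<in> insert i L)" and ?E = "filter (\<lambda>x. x \<in> L)"
        have i_in: "i \<in> set a"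
        proof (rule ccontr)
          assume "i \<notin> set a"
          then have "?F a = ?E a" by (intro filter_cong) auto
          moreover have hd: "hd b1 \<in> L" "hd b1 \<in> set b1" using b * by auto
          ultimately have "?F xs = ?E a @ hd b1 # ?F (tl b1 @ b2 @ c)"
            using b(1,3) by (cases b1) auto
          then have "i = hd (?E a @ [hd b1])" using ord by (metis hd_append list.sel(1))
          then have "i \<in> L" using hd by (cases "?E a") (auto dest: filter_eq_ConsD)
          then show False using * by simp
        qed
        then have notin: "i \<notin> set (?b @ c)" using less.prems(2) b(1) by auto
        then have rest: "?F zs = ?E zs" if "set zs \<subseteq> set (?b @ c)" for zs
          using that by (intro filter_cong) auto
        have "?F a @ ?E (?b @ c) = (i # ?E a) @ ?E (?b @ c)"
          using ord rest[of "?b @ c"] b(1) by simp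
        then have "?F a = i # ?E a" by (simp only: append_same_eq)
        then show ?thesis using rest[of "unshuffle s ?b @ c"]
          by (simp only: filter_append set_append set_unshuffle append_Cons)
      qed
    qed
    have "f ` set ?ys \<subseteq> carrier G" using less.prems(1) set_ys by simp
    from less.hyps[OF sum this dist order] show ?thesis
      unfolding prod set_ys by blast
  qed
qed

end

section \<open>Derivation trees and blocks\<close>

text \<open>
  First-child/next-sibling encoding: in \<open>\<langle>l, i, r\<rangle>\<close> the node \<open>i\<close> is the parent of the roots of \<open>l\<close>
  and the left neighbour of the roots of \<open>r\<close>. Nodes are labelled by \<open>f\<close>.
\<close>

inductive tree_derives ::
    "('n \<times> ('n + 't) list \<times> 'm) set \<Rightarrow> ('i \<Rightarrow> 'm) \<Rightarrow> 'i tree \<Rightarrow> ('n + 't) list \<Rightarrow> 't list \<Rightarrow> bool"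
  for P f where
    Nil: "tree_derives P f \<langle>\<rangle> [] []"
  | Terminal: "tree_derives P f t u x \<Longrightarrow> tree_derives P f t (Inr a # u) (a # x)"
  | Nonterminal: "\<lbrakk>(A, w, f i) \<in> P; tree_derives P f l w x1; tree_derives P f r u x2\<rbrakk> \<Longrightarrow>
      tree_derives P f \<langle>l, i, r\<rangle> (Inl A # u) (x1 @ x2)"

text \<open>In this encoding \<open>set_tree l\<close> holds the proper descendants of
  \<open>i\<close>. Their order is expressed by \<open>filter\<close> because
  \<open>filter_unshuffle\<close> controls how filters react to unshuffling.\<close>

definition scheduled :: "'i tree \<Rightarrow> 'i list \<Rightarrow> bool" where
  "scheduled t xs \<longleftrightarrow> (\<forall>l i r. \<langle>l, i, r\<rangle> \<in> subtrees t \<longrightarrow>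
     filter (\<lambda>x. x \<in> insert i (set_tree l)) xs = i # filter (\<lambda>x. x \<in> set_tree l) xs)"

lemma set_subtree: "s \<in> subtrees t \<Longrightarrow> set_tree s \<subseteq> set_tree t"
  by (induction t) auto

lemma self_in_subtrees [simp, intro]: "t \<in> subtrees t"
  by (cases t) auto

lemma finite_subtrees [simp, intro]: "finite (subtrees t)"
  by (induction t) auto

text \<open>Distinct nodes keep the two branches at every node disjoint. This and
  \<open>subtrees_precedence\<close> supply the hypotheses of \<open>bounded_runs_exists\<close> on
  \<open>\<S>\<close> and \<open>Q\<close>.\<close>

lemma subtrees_laminar:
  assumes "distinct (inorder t)" "a \<in> subtrees t" "b \<in> subtrees t"
  shows "set_tree a \<subseteq> set_tree b \<or> set_tree b \<subseteq> set_tree a \<or> set_tree a \<inter> set_tree b = {}"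
  using assms
proof (induction t)
  case (Node l i r)
  have sub: "set_tree a \<subseteq> set_tree \<langle>l, i, r\<rangle>" "set_tree b \<subseteq> set_tree \<langle>l, i, r\<rangle>"
    using Node.prems set_subtree by blast+
  have d: "distinct (inorder l)" "distinct (inorder r)" "set_tree l \<inter> set_tree r = {}"
    using Node.prems(1) by auto
  consider "a = \<langle>l, i, r\<rangle>" | "b = \<langle>l, i, r\<rangle>" | "a \<in> subtrees l" "b \<in> subtrees l"
    | "a \<in> subtrees r" "b \<in> subtrees r" | "a \<in> subtrees l" "b \<in> subtrees r"
    | "a \<in> subtrees r" "b \<in> subtrees l"
    using Node.prems(2,3) by auto
  then show ?case
  proof cases
    case 1 then show ?thesis using sub by blast
  next
    case 2 then show ?thesis using sub by blast
  next
    case 3 then show ?thesis using Node.IH(1) d by blast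
  next
    case 4 then show ?thesis using Node.IH(2) d by blast
  next
    case 5 then show ?thesis using set_subtree[of a l] set_subtree[of b r] d by blast
  next
    case 6 then show ?thesis using set_subtree[of a r] set_subtree[of b l] d by blast
  qed
qed simp

text \<open>Subtrees are closed under descent, so a precedence constraint crosses the border of
  \<open>s\<close> only if all of \<open>s\<close> lies below \<open>i\<close>.\<close>

lemma subtrees_precedence:
  assumes "distinct (inorder t)" "s \<in> subtrees t" "\<langle>l, i, r\<rangle> \<in> subtrees t"
  shows "insert i (set_tree l) \<subseteq> set_tree s \<or> insert i (set_tree l) \<inter> set_tree s = {} \<or>
    set_tree s \<subseteq> set_tree l \<and> i \<notin> set_tree l"
  using assms
proof (induction t)
  case (Node l' i' r')
  have d: "distinct (inorder l')" "distinct (inorder r')" "set_tree l' \<inter> set_tree r' = {}"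
      "i' \<notin> set_tree l'" "i' \<notin> set_tree r'"
    using Node.prems(1) by auto
  have in_sub: "insert i (set_tree l) \<subseteq> set_tree t" if "\<langle>l, i, r\<rangle> \<in> subtrees t" for t
    using set_subtree[OF that] by auto
  consider "s = \<langle>l', i', r'\<rangle>" | "s \<in> subtrees l'" "\<langle>l, i, r\<rangle> = \<langle>l', i', r'\<rangle>"
    | "s \<in> subtrees r'" "\<langle>l, i, r\<rangle> = \<langle>l', i', r'\<rangle>"
    | "s \<in> subtrees l'" "\<langle>l, i, r\<rangle> \<in> subtrees l'" | "s \<in> subtrees r'" "\<langle>l, i, r\<rangle> \<in> subtrees r'"
    | "s \<in> subtrees l'" "\<langle>l, i, r\<rangle> \<in> subtrees r'" | "s \<in> subtrees r'" "\<langle>l, i, r\<rangle> \<in> subtrees l'"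
    using Node.prems(2,3) by auto
  then show ?case
  proof cases
    case 1 then show ?thesis using in_sub Node.prems(3) by blast
  next
    case 2 then show ?thesis using set_subtree[of s l'] d by auto
  next
    case 3 then show ?thesis using set_subtree[of s r'] d by auto
  next
    case 4 then show ?thesis using Node.IH(1) d by blast
  next
    case 5 then show ?thesis using Node.IH(2) d by blast
  next
    case 6 then show ?thesis using set_subtree[of s l'] in_sub[of r'] d by blast
  next
    case 7 then show ?thesis using set_subtree[of s r'] in_sub[of l'] d by blast
  qed
qed simp

text \<open>The condition looks only at nodes of \<open>t\<close>, so a schedule of one branch may
  be replaced by a common schedule that contains it.\<close>

lemma scheduled_filter:
  assumes "scheduled t ys" "ys = filter (\<lambda>x. x \<in> s) xs" "set_tree t \<subseteq> s"
  shows "scheduled t xs"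
  unfolding scheduled_def
proof (intro allI impI)
  fix l i r assume *: "\<langle>l, i, r\<rangle> \<in> subtrees t"
  have "insert i (set_tree l) \<subseteq> s" using set_subtree[OF *] assms(3) by auto
  then have "x \<in> s \<and> x \<in> insert i (set_tree l) \<longleftrightarrow> x \<in> insert i (set_tree l)"
      "x \<in> s \<and> x \<in> set_tree l \<longleftrightarrow> x \<in> set_tree l" for x by auto
  moreover have "filter (\<lambda>x. x \<in> insert i (set_tree l)) ys = i # filter (\<lambda>x. x \<in> set_tree l) ys"
    using assms(1) * unfolding scheduled_def by blast
  ultimately show "filter (\<lambda>x. x \<in> insert i (set_tree l)) xs = i # filter (\<lambda>x. x \<in> set_tree l) xs"
    unfolding assms(2) filter_filter by (simp only:)
qed

lemma distinct_shuffles_disjoint: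
  assumes "zs \<in> shuffles xs ys" "distinct zs"
  shows "distinct xs \<and> distinct ys \<and> set xs \<inter> set ys = {}"
  using assms
proof (induction zs arbitrary: xs ys)
  case Nil
  then show ?case by simp
next
  case (Cons z zs)
  from Cons.prems(1) show ?case
  proof (cases rule: shuffles_Cons_cases)
    case (left xs')
    then have "z \<notin> set xs' \<union> set ys" using Cons.prems(2) set_shuffles[OF left(2)] by auto
    then show ?thesis using Cons.IH[OF left(2)] Cons.prems(2) left(1) by auto
  next
    case (right ys')
    then have "z \<notin> set xs \<union> set ys'" using Cons.prems(2) set_shuffles[OF right(2)] by auto
    then show ?thesis using Cons.IH[OF right(2)] Cons.prems(2) right(1) by auto
  qed
qed

text \<open>Distinct names \<open>xs\<close> for the letters of the label word become the nodes. The
  interleavings in the derivation distribute them over the branches, and \<open>xs\<close> itself is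
  the schedule.\<close>

lemma tree_derives_exists:
  assumes "derives P u ws x" "distinct xs" "map f xs = ws"
  shows "\<exists>t. tree_derives P f t u x \<and> set_tree t = set xs \<and> distinct (inorder t) \<and> scheduled t xs"
  using assms
proof (induction arbitrary: xs rule: derives.induct)
  case Nil
  then show ?case
    by (intro exI[of _ "\<langle>\<rangle>"]) (auto simp: scheduled_def intro: tree_derives.Nil)
next
  case (Terminal u ws x a)
  then obtain t where "tree_derives P f t u x" "set_tree t = set xs" "distinct (inorder t)"
      "scheduled t xs" by blast
  then show ?case
    using tree_derives.Terminal[of P f t u x a] by (intro exI[of _ t]) simp
next
  case (Nonterminal A w c ws1 x1 u ws2 x2 ws)
  then have "map f xs \<in> shuffles (c # ws1) ws2" by simp
  then obtain zs ys where 1: "xs \<in> shuffles zs ys" "map f zs = c # ws1" "map f ys = ws2"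
    by (elim map_in_shufflesE)
  then obtain i zs' where 2: "zs = i # zs'" "f i = c" "map f zs' = ws1" by auto
  have d: "distinct (i # zs')" "distinct ys" "set (i # zs') \<inter> set ys = {}"
    using distinct_shuffles_disjoint[OF 1(1) Nonterminal.prems(1)] 2(1) by auto
  obtain l where l: "tree_derives P f l w x1" "set_tree l = set zs'" "distinct (inorder l)"
      "scheduled l zs'"
    using Nonterminal.IH(1)[OF _ 2(3)] d by auto
  obtain r where r: "tree_derives P f r u x2" "set_tree r = set ys" "distinct (inorder r)"
      "scheduled r ys"
    using Nonterminal.IH(2)[OF d(2) 1(3)] by auto
  have fzs: "filter (\<lambda>x. x \<in> set zs) xs = zs" and fys: "filter (\<lambda>x. x \<in> set ys) xs = ys"
    using filter_shuffles_disjoint1(1)[OF _ 1(1)] filter_shuffles_disjoint2(1)[OF _ 1(1)] d 2(1)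
    by auto
  have fl: "filter (\<lambda>x. x \<in> set_tree l) xs = zs'"
  proof -
    have "filter (\<lambda>x. x \<in> set_tree l) xs = filter (\<lambda>x. x \<in> set zs \<and> x \<in> set_tree l) xs"
      using l(2) 2(1) by (intro filter_cong) auto
    also have "\<dots> = filter (\<lambda>x. x \<in> set_tree l) (filter (\<lambda>x. x \<in> set zs) xs)"
      by (simp only: filter_filter)
    also have "\<dots> = filter (\<lambda>x. x \<in> set_tree l) (i # zs')" unfolding fzs by (simp only: 2(1))
    also have "\<dots> = zs'" using d(1) l(2) by simp
    finally show ?thesis .
  qed
  have fil: "filter (\<lambda>x. x \<in> insert i (set_tree l)) xs = i # zs'"
    using fzs 2(1) l(2) by simp
  have "scheduled l xs" using scheduled_filter[OF l(4) fl[symmetric]] by simp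
  moreover have "scheduled r xs" using scheduled_filter[OF r(4) fys[symmetric]] r(2) by simp
  ultimately have "scheduled \<langle>l, i, r\<rangle> xs"
    using fl fil unfolding scheduled_def subtrees.simps by blast
  moreover have "tree_derives P f \<langle>l, i, r\<rangle> (Inl A # u) (x1 @ x2)"
    using tree_derives.Nonterminal[OF _ l(1) r(1)] Nonterminal.hyps(1) 2(2) by blast
  moreover have "set_tree \<langle>l, i, r\<rangle> = set xs"
    using set_shuffles[OF 1(1)] l(2) r(2) 2(1) by auto
  moreover have "distinct (inorder \<langle>l, i, r\<rangle>)"
    using d l r by auto
  ultimately show ?case by blast
qed

section \<open>Blocks, the contents of the runs\<close>

fun blocks :: "'i set \<Rightarrow> 'i list \<Rightarrow> 'i list list" where
  "blocks s [] = []"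
| "blocks s (x # xs) = (if x \<notin> s then blocks s xs
     else if xs \<noteq> [] \<and> hd xs \<in> s then (x # hd (blocks s xs)) # tl (blocks s xs)
     else [x] # blocks s xs)"

lemma blocks_nonempty: "xs \<noteq> [] \<Longrightarrow> hd xs \<in> s \<Longrightarrow> blocks s xs \<noteq> []"
  by (cases xs) auto

lemma length_blocks: "length (blocks s xs) = runs s False xs"
proof (induction xs)
  case (Cons x xs)
  show ?case
  proof (cases "x \<in> s \<and> xs \<noteq> [] \<and> hd xs \<in> s")
    case True
    then have "runs s False xs = Suc (runs s True xs)" by (cases xs) auto
    then show ?thesis using True Cons.IH blocks_nonempty[of xs s] by simp
  next
    case False
    then have "x \<in> s \<Longrightarrow> runs s True xs = runs s False xs" by (cases xs) auto
    then show ?thesis using False Cons.IH by auto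
  qed
qed simp

lemma concat_blocks: "concat (blocks s xs) = filter (\<lambda>x. x \<in> s) xs"
proof (induction xs)
  case (Cons x xs)
  show ?case
  proof (cases "x \<in> s \<and> xs \<noteq> [] \<and> hd xs \<in> s")
    case True
    then obtain b bs where "blocks s xs = b # bs" using blocks_nonempty by (meson list.exhaust)
    then show ?thesis using True Cons.IH by simp
  qed (use Cons.IH in auto)
qed simp

lemma blocks_all: "set xs \<subseteq> s \<Longrightarrow> xs \<noteq> [] \<Longrightarrow> blocks s xs = [xs]"
proof (induction xs)
  case (Cons x xs)
  then show ?case by (cases xs) auto
qed simp

lemma blocks_cong: "(\<And>x. x \<in> set xs \<Longrightarrow> x \<in> s \<longleftrightarrow> x \<in> t) \<Longrightarrow> blocks s xs = blocks t xs"
proof (induction xs)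
  case (Cons x xs)
  then have "blocks s xs = blocks t xs" "x \<in> s \<longleftrightarrow> x \<in> t" by auto
  moreover have "xs \<noteq> [] \<Longrightarrow> hd xs \<in> s \<longleftrightarrow> hd xs \<in> t" using Cons.prems[of "hd xs"] by simp
  ultimately show ?case by auto
qed simp

lemma blocks_append_disjoint: "set a \<inter> s = {} \<Longrightarrow> blocks s (a @ xs) = blocks s xs"
  by (induction a) auto

text \<open>Nothing of \<open>insert i L\<close> occurs before \<open>i\<close>, so \<open>i\<close>
  is a block by itself or stands immediately before the first block of \<open>L\<close> and extends
  it. These are the two cases of \<open>root_merges\<close>.\<close>

lemma blocks_insert:
  assumes "distinct xs" "i \<notin> L"
    and "filter (\<lambda>x. x \<in> insert i L) xs = i # filter (\<lambda>x. x \<in> L) xs"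
  shows "blocks (insert i L) xs = [i] # blocks L xs \<or>
    (\<exists>b bs. blocks L xs = b # bs \<and> blocks (insert i L) xs = (i # b) # bs)"
proof -
  obtain a z where xs: "xs = a @ i # z" "\<forall>x \<in> set a. x \<notin> insert i L"
    using filter_eq_ConsD[OF assms(3)] by auto
  have "blocks (insert i L) z = blocks L z"
    using assms(1) xs by (intro blocks_cong) auto
  moreover have "blocks (insert i L) xs = blocks (insert i L) (i # z)"
    unfolding xs(1) using xs(2) by (intro blocks_append_disjoint) auto
  moreover have "blocks L xs = blocks L (i # z)"
    unfolding xs(1) using xs(2) by (intro blocks_append_disjoint) auto
  moreover have "z \<noteq> [] \<Longrightarrow> hd z \<noteq> i" using assms(1) xs(1) by (cases z) auto
  moreover have "z \<noteq> [] \<Longrightarrow> hd z \<in> L \<Longrightarrow> \<exists>b bs. blocks L z = b # bs"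
    using blocks_nonempty by (meson list.exhaust)
  ultimately show ?thesis using assms(2) by (cases "z \<noteq> [] \<and> hd z \<in> L") auto
qed

text \<open>Tags mark the origin of a block: \<open>True\<close> for \<open>A\<close>, \<open>False\<close> for \<open>C\<close>.\<close>

lemma blocks_Un:
  assumes "A \<inter> C = {}"
  shows "\<exists>zs. map snd (filter fst (concat zs)) = blocks A xs \<and>
    map snd (filter (\<lambda>p. \<not> fst p) (concat zs)) = blocks C xs \<and>
    map (\<lambda>q. concat (map snd q)) zs = blocks (A \<union> C) xs \<and>
    (xs \<noteq> [] \<and> hd xs \<in> A \<union> C \<longrightarrow> (\<exists>h q zs'. zs = ((hd xs \<in> A, h) # q) # zs'))"
proof (induction xs)
  case Nil
  show ?case by (intro exI[of _ "[]"]) simp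
next
  case (Cons x xs)
  then obtain zs where zs: "map snd (filter fst (concat zs)) = blocks A xs"
    "map snd (filter (\<lambda>p. \<not> fst p) (concat zs)) = blocks C xs"
    "map (\<lambda>q. concat (map snd q)) zs = blocks (A \<union> C) xs"
    "xs \<noteq> [] \<and> hd xs \<in> A \<union> C \<longrightarrow> (\<exists>h q zs'. zs = ((hd xs \<in> A, h) # q) # zs')"
    by (elim exE conjE)
  have disj: "y \<in> A \<Longrightarrow> y \<notin> C" for y using assms by auto
  show ?case
  proof (cases "x \<in> A \<union> C")
    case False
    then show ?thesis using zs by (intro exI[of _ zs]) simp
  next
    case x: True
    show ?thesis
    proof (cases "xs \<noteq> [] \<and> hd xs \<in> A \<union> C")
      case False
      then show ?thesis using zs x disj
        by (intro exI[of _ "[(x \<in> A, [x])] # zs"]) auto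
    next
      case True
      \<comment> \<open>The first entry of the first group is tagged with the origin of
        \<open>hd xs\<close>. If \<open>x\<close> has the same origin, it extends that entry;
        otherwise it opens a new entry in the same group.\<close>
      then obtain h q zs' where z: "zs = ((hd xs \<in> A, h) # q) # zs'" using zs(4) by auto
      show ?thesis
      proof (cases "hd xs \<in> A \<longleftrightarrow> x \<in> A")
        case same: True
        show ?thesis using zs(1-3) x True same disj unfolding z
          by (intro exI[of _ "((x \<in> A, x # h) # q) # zs'"])
            (cases "x \<in> A"; auto simp flip: zs(1-3))
      next
        case False
        show ?thesis using zs(1-3) x True False disj unfolding z
          by (intro exI[of _ "((x \<in> A, [x]) # (hd xs \<in> A, h) # q) # zs'"])
            (cases "x \<in> A"; auto simp flip: zs(1-3))
      qed
    qed
  qed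
qed

section \<open>Derivations annotated with block products\<close>

text \<open>
  In a merge of \<open>v1\<close> and \<open>v2\<close> into \<open>v\<close> the entries of \<open>v1\<close> (tagged \<open>True\<close>) and \<open>v2\<close> are interleaved,
  and the result is cut into groups whose products are the entries of \<open>v\<close>. The root label \<open>c\<close> either
  precedes the first entry of \<open>v1\<close> or is absorbed by it.
\<close>

definition merges :: "('m, 'b) monoid_scheme \<Rightarrow> 'm list \<Rightarrow> 'm list \<Rightarrow> 'm list \<Rightarrow> bool" where
  "merges M v1 v2 v \<longleftrightarrow> (\<exists>zs. v1 = map snd (filter fst (concat zs)) \<and>
     v2 = map snd (filter (\<lambda>p. \<not> fst p) (concat zs)) \<and> v = map (\<lambda>q. word_prod M (map snd q)) zs)"

definition root_merges :: "('m, 'b) monoid_scheme \<Rightarrow> 'm \<Rightarrow> 'm list \<Rightarrow> 'm list \<Rightarrow> 'm list \<Rightarrow> bool" where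
  "root_merges M c v1 v2 v \<longleftrightarrow> merges M (c # v1) v2 v \<or>
     (\<exists>h t. v1 = h # t \<and> merges M ((c \<otimes>\<^bsub>M\<^esub> h) # t) v2 v)"

text \<open>
  \<open>v\<close> records the products of the blocks into which the steps of this part of the derivation fall when
  they are interleaved with the rest of a derivation.
\<close>

inductive block_derives ::
    "('m, 'b) monoid_scheme \<Rightarrow> ('n \<times> ('n + 't) list \<times> 'm) set \<Rightarrow> 'm list set \<Rightarrow>
     ('n + 't) list \<Rightarrow> 'm list \<Rightarrow> 't list \<Rightarrow> bool"
  for M P V where
    Nil: "block_derives M P V [] [] []"
  | Terminal: "block_derives M P V u v x \<Longrightarrow> block_derives M P V (Inr a # u) v (a # x)"
  | Nonterminal: "\<lbrakk>(A, w, c) \<in> P; block_derives M P V w v1 x1; block_derives M P V u v2 x2;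
      root_merges M c v1 v2 v; v \<in> V\<rbrakk> \<Longrightarrow> block_derives M P V (Inl A # u) v (x1 @ x2)"

lemma block_derives_in: "block_derives M P V u v x \<Longrightarrow> [] \<in> V \<Longrightarrow> v \<in> V"
  by (induction rule: block_derives.induct) auto

text \<open>Each entry of \<open>z\<close> is replaced by a word that \<open>g\<close> maps to it,
  taken from \<open>xss\<close> or \<open>yss\<close> according to its tag. Whole words are placed
  one after another, so the concatenations are interleaved.\<close>

lemma tagged_shuffle:
  assumes "map g xss = map snd (filter fst z)" "map g yss = map snd (filter (\<lambda>p. \<not> fst p) z)"
  shows "\<exists>zss. map g zss = map snd z \<and> concat zss \<in> shuffles (concat xss) (concat yss)"
  using assms
proof (induction z arbitrary: xss yss)
  case Nil
  then show ?case by (intro exI[of _ "[]"]) auto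
next
  case (Cons p z)
  show ?case
  proof (cases "fst p")
    case True
    with Cons.prems obtain xs xss' where xss: "xss = xs # xss'" "g xs = snd p"
        "map g xss' = map snd (filter fst z)" by auto
    have "map g yss = map snd (filter (\<lambda>p. \<not> fst p) z)" using Cons.prems(2) True by simp
    then obtain zss where "map g zss = map snd z" "concat zss \<in> shuffles (concat xss') (concat yss)"
      using Cons.IH[OF xss(3)] by blast
    then show ?thesis using xss(1,2)
      by (intro exI[of _ "xs # zss"]) (simp add: shuffles_append_left)
  next
    case False
    with Cons.prems obtain ys yss' where yss: "yss = ys # yss'" "g ys = snd p"
        "map g yss' = map snd (filter (\<lambda>p. \<not> fst p) z)" by auto
    have "map g xss = map snd (filter fst z)" using Cons.prems(1) False by simp
    then obtain zss where "map g zss = map snd z" "concat zss \<in> shuffles (concat xss) (concat yss')"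
      using Cons.IH[OF _ yss(3)] by blast
    then show ?thesis using yss(1,2)
      by (intro exI[of _ "ys # zss"]) (simp add: shuffles_append_right)
  qed
qed

lemma map_eq_concatD:
  assumes "map g xs = concat zss"
  shows "\<exists>xss. concat xss = xs \<and> map (map g) xss = zss"
  using assms
proof (induction zss arbitrary: xs)
  case Nil
  then show ?case by simp
next
  case (Cons zs zss)
  then obtain us vs where "xs = us @ vs" "map g us = zs" "map g vs = concat zss"
    by (auto simp: map_eq_append_conv)
  moreover obtain xss where "concat xss = vs" "map (map g) xss = zss"
    using Cons.IH calculation(3) by blast
  ultimately show ?case by (intro exI[of _ "us # xss"]) simp
qed

section \<open>Passing between annotations and derivations\<close>

context monoid
begin

lemma merges_shuffle:
  assumes "merges G (map (word_prod G) xss) (map (word_prod G) yss) v"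
    and "set (concat xss) \<subseteq> carrier G" "set (concat yss) \<subseteq> carrier G"
  shows "\<exists>zss. map (word_prod G) zss = v \<and> concat zss \<in> shuffles (concat xss) (concat yss)"
proof -
  obtain zs where zs: "map (word_prod G) xss = map snd (filter fst (concat zs))"
     "map (word_prod G) yss = map snd (filter (\<lambda>p. \<not> fst p) (concat zs))"
     "v = map (\<lambda>q. word_prod G (map snd q)) zs"
    using assms(1) unfolding merges_def by blast
  obtain uss where uss: "map (word_prod G) uss = map snd (concat zs)"
      "concat uss \<in> shuffles (concat xss) (concat yss)"
    using tagged_shuffle[OF zs(1,2)] by blast
  have "map (word_prod G) uss = concat (map (map snd) zs)"
    using uss(1) by (simp add: map_concat)
  then obtain usss where usss: "concat usss = uss" "map (map (word_prod G)) usss = map (map snd) zs"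
    using map_eq_concatD by blast
  have "set (concat uss) \<subseteq> carrier G"
    using set_shuffles[OF uss(2)] assms(2,3) by auto
  then have car: "set us \<subseteq> carrier G" if "us \<in> set vss" "vss \<in> set usss" for us vss
    using that unfolding usss(1)[symmetric] by auto
  \<comment> \<open>The grouping of \<open>zs\<close> carries over to the words; the product of a
    joined group is the product of its products.\<close>
  have "map (word_prod G) (map concat usss) = map (word_prod G) (map (map (word_prod G)) usss)"
    unfolding map_map using car by (intro map_cong) (auto simp: word_prod_concat)
  also have "\<dots> = v" unfolding usss(2) zs(3) by simp
  finally have "map (word_prod G) (map concat usss) = v" .
  moreover have "concat (map concat usss) = concat uss"
    unfolding usss(1)[symmetric] by (induction usss) auto
  ultimately show ?thesis using uss(2) by (intro exI[of _ "map concat usss"]) simp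
qed

text \<open>Soundness of the annotations: bottom-up, every recorded product is realised by a word,
  and the guessed merge dictates how the words of the two parts are interleaved.\<close>

lemma derives_if_block_derives:
  assumes "block_derives G P V u v x" "(snd \<circ> snd) ` P \<subseteq> carrier G"
  shows "\<exists>wss. map (word_prod G) wss = v \<and> derives P u (concat wss) x"
  using assms(1)
proof (induction rule: block_derives.induct)
  case Nil
  show ?case by (intro exI[of _ "[]"]) (simp add: derives.Nil)
next
  case (Terminal u v x a)
  then obtain wss where "map (word_prod G) wss = v" "derives P u (concat wss) x" by blast
  then show ?case
    using derives.Terminal[of P u "concat wss" x a] by (intro exI[of _ wss]) simp
next
  case (Nonterminal A w c v1 x1 u v2 x2 v)
  obtain xss where xss: "map (word_prod G) xss = v1" "derives P w (concat xss) x1"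
    using Nonterminal.IH(1) by blast
  obtain yss where yss: "map (word_prod G) yss = v2" "derives P u (concat yss) x2"
    using Nonterminal.IH(2) by blast
  have c: "c \<in> carrier G" using Nonterminal.hyps(1) assms(2) by force
  have car: "set (concat xss) \<subseteq> carrier G" "set (concat yss) \<subseteq> carrier G"
    using derives_labels[OF xss(2)] derives_labels[OF yss(2)] assms(2) by blast+
  \<comment> \<open>The root label forms a block of its own or is put in front of the first block;
    the concatenation is the same.\<close>
  obtain xss' where xss': "concat xss' = c # concat xss" "merges G (map (word_prod G) xss') v2 v"
  proof -
    from Nonterminal.hyps(4) consider "merges G (c # v1) v2 v"
      | h t where "v1 = h # t" "merges G ((c \<otimes> h) # t) v2 v"
      unfolding root_merges_def by blast
    then show ?thesis
    proof cases
      case 1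
      then show ?thesis using that[of "[c] # xss"] xss(1) c by simp
    next
      case 2
      then obtain xs xss'' where "xss = xs # xss''" "word_prod G xs = h" "map (word_prod G) xss'' = t"
        using xss(1) by auto
      then show ?thesis using that[of "(c # xs) # xss''"] 2 by simp
    qed
  qed
  then have "set (concat xss') \<subseteq> carrier G" using car c by simp
  then obtain zss where "map (word_prod G) zss = v" "concat zss \<in> shuffles (concat xss') (concat yss)"
    using merges_shuffle[of xss' yss v] xss'(2) yss(1) car(2) by blast
  then show ?case
    using derives.Nonterminal[OF Nonterminal.hyps(1) xss(2) yss(2)] xss'(1) by auto
qed

text \<open>By \<open>blocks_Un\<close> each block of the union is a concatenation of blocks of
  \<open>A\<close> and \<open>C\<close>, so its product is the product of theirs.\<close>

lemma merges_blocks: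
  assumes "A \<inter> C = {}" "f ` set xs \<subseteq> carrier G"
  defines "bp \<equiv> \<lambda>s. map (\<lambda>b. word_prod G (map f b)) (blocks s xs)"
  shows "merges G (bp A) (bp C) (bp (A \<union> C))"
proof -
  obtain zs where zs: "map snd (filter fst (concat zs)) = blocks A xs"
    "map snd (filter (\<lambda>p. \<not> fst p) (concat zs)) = blocks C xs"
    "map (\<lambda>q. concat (map snd q)) zs = blocks (A \<union> C) xs"
    using blocks_Un[OF assms(1), of xs] by (elim exE conjE)
  let ?p = "map_prod id (\<lambda>b. word_prod G (map f b))"
  let ?zs = "map (map ?p) zs"
  have "concat ?zs = map ?p (concat zs)" by (simp add: map_concat)
  then have 1: "map snd (filter fst (concat ?zs)) = bp A"
      "map snd (filter (\<lambda>p. \<not> fst p) (concat ?zs)) = bp C"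
    unfolding bp_def zs(1,2)[symmetric] by (simp_all add: filter_map comp_def)
  have "word_prod G (map snd (map ?p q)) = word_prod G (map f (concat (map snd q)))"
    if q: "q \<in> set zs" for q
  proof -
    have "set (map f ys) \<subseteq> carrier G" if "ys \<in> set (map snd q)" for ys
    proof -
      have "set ys \<subseteq> set (concat (blocks (A \<union> C) xs))"
        using that q unfolding zs(3)[symmetric] by force
      then show ?thesis using assms(2) unfolding concat_blocks by auto
    qed
    then have "word_prod G (concat (map (map f \<circ> snd) q)) = word_prod G (map (word_prod G) (map (map f \<circ> snd) q))"
      by (intro word_prod_concat) fastforce
    then show ?thesis by (simp add: map_concat comp_def)
  qed
  then have "map (\<lambda>q. word_prod G (map snd q)) ?zs = bp (A \<union> C)"
    unfolding bp_def zs(3)[symmetric] by simp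
  then show ?thesis unfolding merges_def using 1 by metis
qed

text \<open>All subtrees are annotated with their block products in one global schedule
  \<open>xs\<close>; the bound on the number of blocks keeps the annotations in a set of words of
  bounded length.\<close>

lemma block_derives_if_tree_derives:
  assumes "tree_derives P f t u x" "distinct (inorder t)" "distinct xs" "scheduled t xs"
    "f ` set xs \<subseteq> carrier G"
    "\<And>s. s \<in> subtrees t \<Longrightarrow> length (blocks (set_tree s) xs) \<le> n"
  shows "block_derives G P {v. set v \<subseteq> carrier G \<and> length v \<le> n} u
    (map (\<lambda>b. word_prod G (map f b)) (blocks (set_tree t) xs)) x"
  using assms(1,2,4,6)
proof (induction rule: tree_derives.induct)
  case Nil
  have "blocks {} xs = []" by (induction xs) auto
  then show ?case by (simp add: block_derives.Nil)
next
  case (Terminal t u x a)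
  then show ?case by (simp add: block_derives.Terminal)
next
  case (Nonterminal A w i l x1 r u x2)
  let ?bp = "\<lambda>s. map (\<lambda>b. word_prod G (map f b)) (blocks s xs)"
  let ?V = "{v. set v \<subseteq> carrier G \<and> length v \<le> n}"
  let ?L = "set_tree l" and ?R = "set_tree r"
  have d: "distinct (inorder l)" "distinct (inorder r)" "i \<notin> ?L" "insert i ?L \<inter> ?R = {}"
    using Nonterminal.prems(1) by auto
  have sch: "scheduled l xs" "scheduled r xs"
      "filter (\<lambda>x. x \<in> insert i ?L) xs = i # filter (\<lambda>x. x \<in> ?L) xs"
    using Nonterminal.prems(2) unfolding scheduled_def subtrees.simps by blast+
  have len: "length (blocks (set_tree s) xs) \<le> n" if "s = \<langle>l, i, r\<rangle> \<or> s \<in> subtrees l \<or> s \<in> subtrees r" for s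
    using Nonterminal.prems(3)[of s] that by auto
  have l: "block_derives G P ?V w (?bp ?L) x1"
    using Nonterminal.IH(1) d(1) sch(1) len by blast
  have r: "block_derives G P ?V u (?bp ?R) x2"
    using Nonterminal.IH(2) d(2) sch(2) len by blast
  \<comment> \<open>A subtree consists of \<open>i\<close> with its descendants,
    \<open>insert i ?L\<close>, and of the right siblings with theirs, \<open>?R\<close>.\<close>
  have mg: "merges G (?bp (insert i ?L)) (?bp ?R) (?bp (set_tree \<langle>l, i, r\<rangle>))"
    using merges_blocks[OF d(4) assms(5)] by (simp add: insert_commute)
  have "i \<in> set xs"
    using arg_cong[OF sch(3), of set] by auto
  then have fi: "f i \<in> carrier G" using assms(5) by auto
  have "root_merges G (f i) (?bp ?L) (?bp ?R) (?bp (set_tree \<langle>l, i, r\<rangle>))"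
    using blocks_insert[OF assms(3) d(3) sch(3)]
  proof
    assume "blocks (insert i ?L) xs = [i] # blocks ?L xs"
    then show ?thesis using mg fi by (simp add: root_merges_def)
  next
    assume "\<exists>b bs. blocks ?L xs = b # bs \<and> blocks (insert i ?L) xs = (i # b) # bs"
    then show ?thesis using mg by (auto simp: root_merges_def)
  qed
  moreover have "?bp (set_tree \<langle>l, i, r\<rangle>) \<in> ?V"
  proof -
    have "set (concat (blocks (set_tree \<langle>l, i, r\<rangle>) xs)) \<subseteq> set xs"
      unfolding concat_blocks by auto
    then have "set (map f b) \<subseteq> carrier G" if "b \<in> set (blocks (set_tree \<langle>l, i, r\<rangle>) xs)" for b
      using that assms(5) by fastforce
    then show ?thesis using len[of "\<langle>l, i, r\<rangle>"] by auto
  qed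
  ultimately show ?case
    using block_derives.Nonterminal[OF Nonterminal.hyps(1) l r] by blast
qed

end

text \<open>The positions of \<open>ws\<close> serve as nodes. \<open>bounded_runs_exists\<close>
  makes all runs few without changing the product, and the whole tree is a single block.\<close>

lemma (in group) block_derives_complete:
  assumes fin: "finite (carrier G)" and P: "(snd \<circ> snd) ` P \<subseteq> carrier G"
    and "derives P (Inl S # u) ws x"
  shows "block_derives G P {v. set v \<subseteq> carrier G \<and> length v \<le> 2 * card (carrier G) ^ 3}
    (Inl S # u) [word_prod G ws] x"
proof -
  define f where "f = (\<lambda>i. ws ! i)"
  define xs where "xs = [0..<length ws]"
  have xs: "distinct xs" "map f xs = ws" by (simp_all add: xs_def f_def map_nth)
  obtain t where t: "tree_derives P f t (Inl S # u) x" "set_tree t = set xs"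
      "distinct (inorder t)" "scheduled t xs"
    using tree_derives_exists[OF assms(3) xs] by blast
  have f: "f ` set xs \<subseteq> carrier G"
    using derives_labels[OF assms(3)] P xs(2) by (metis image_set subset_trans)
  let ?Q = "{(i, set_tree l) | l i r. \<langle>l, i, r\<rangle> \<in> subtrees t}"
  have "\<exists>ys. distinct ys \<and> set ys = set xs \<and>
    word_prod G (map f ys) = word_prod G (map f xs) \<and>
    (\<forall>(i, L) \<in> ?Q. filter (\<lambda>x. x \<in> insert i L) ys = i # filter (\<lambda>x. x \<in> L) ys) \<and>
    (\<forall>s \<in> set_tree ` subtrees t. runs s False ys \<le> 2 * card (carrier G) ^ 3)"
  proof (rule bounded_runs_exists[OF fin f])
    show "finite (set_tree ` subtrees t)" by simp
    show "s' \<subseteq> s \<or> s \<subseteq> s' \<or> s' \<inter> s = {}"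
      if "s \<in> set_tree ` subtrees t" "s' \<in> set_tree ` subtrees t" for s s'
      using that subtrees_laminar[OF t(3)] by blast
    show "insert i L \<subseteq> s \<or> insert i L \<inter> s = {} \<or> s \<subseteq> L \<and> i \<notin> L"
      if "s \<in> set_tree ` subtrees t" "(i, L) \<in> ?Q" for s i L
      using that subtrees_precedence[OF t(3)] by blast
    show "distinct xs" by (fact xs(1))
    show "filter (\<lambda>x. x \<in> insert i L) xs = i # filter (\<lambda>x. x \<in> L) xs" if "(i, L) \<in> ?Q" for i L
      using that t(4) unfolding scheduled_def by blast
  qed
  then obtain ys where ys: "distinct ys" "set ys = set xs"
    "word_prod G (map f ys) = word_prod G (map f xs)"
    "\<forall>(i, L) \<in> ?Q. filter (\<lambda>x. x \<in> insert i L) ys = i # filter (\<lambda>x. x \<in> L) ys"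
    "\<forall>s \<in> set_tree ` subtrees t. runs s False ys \<le> 2 * card (carrier G) ^ 3"
    by (elim exE conjE)
  have "scheduled t ys" using ys(4) unfolding scheduled_def by blast
  moreover have "f ` set ys \<subseteq> carrier G" using f ys(2) by simp
  moreover have "length (blocks (set_tree s) ys) \<le> 2 * card (carrier G) ^ 3" if "s \<in> subtrees t" for s
    using ys(5) that by (simp add: length_blocks)
  ultimately have bd: "block_derives G P {v. set v \<subseteq> carrier G \<and> length v \<le> 2 * card (carrier G) ^ 3}
      (Inl S # u) (map (\<lambda>b. word_prod G (map f b)) (blocks (set_tree t) ys)) x"
    by (intro block_derives_if_tree_derives[OF t(1,3) ys(1)])
  \<comment> \<open>The leading nonterminal excludes the empty tree, which would have no block
    instead of one.\<close>
  have "t \<noteq> \<langle>\<rangle>" using t(1) by (auto elim: tree_derives.cases)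
  then have "ys \<noteq> []" using t(2) ys(2) by (cases t) auto
  then have "blocks (set_tree t) ys = [ys]" using t(2) ys(2) by (intro blocks_all) auto
  then show ?thesis using bd ys(3) xs(2) by simp
qed

section \<open>Context-free grammars\<close>

definition rename_productions ::
    "('n \<Rightarrow> 'k) \<Rightarrow> ('n \<times> ('n + 't) list \<times> 'm) set \<Rightarrow> ('k \<times> ('k + 't) list \<times> 'm) set" where
  "rename_productions e P = (\<lambda>(A, w, c). (e A, map (map_sum e id) w, c)) ` P"

lemma derives_rename:
  "derives P u ws x \<Longrightarrow> derives (rename_productions e P) (map (map_sum e id) u) ws x"
proof (induction rule: derives.induct)
  case (Nonterminal A w c ws1 x1 u ws2 x2 ws)
  have "(e A, map (map_sum e id) w, c) \<in> rename_productions e P"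
    using Nonterminal.hyps(1) unfolding rename_productions_def by (force simp: image_iff)
  from derives.Nonterminal[OF this Nonterminal.IH Nonterminal.hyps(4)] show ?case by simp
qed (simp_all add: derives.Nil derives.Terminal)

text \<open>Over the trivial monoid every label word has product \<open>\<one>\<close>, so any
  derivation counts; it remains to move the nonterminals to \<open>nat\<close> along an
  injection.\<close>

lemma context_freeI:
  fixes P :: "('n \<times> ('n + 't) list \<times> unit) set"
  assumes "finite N" "finite T" "finite P" "P \<subseteq> N \<times> lists (N <+> T) \<times> UNIV" "S \<in> N"
  shows "context_free {x. \<exists>ws. derives P [Inl S] ws x}"
proof -
  obtain e :: "'n \<Rightarrow> nat" where e: "inj_on e N"
    using finite_imp_inj_to_nat_seg[OF assms(1)] by blast
  \<comment> \<open>A left inverse of \<open>e\<close> on \<open>N\<close>: it undoes the renaming,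
    so \<open>derives_rename\<close> works in both directions.\<close>
  define g where "g = inv_into N e"
  have ge: "g (e A) = A" if "A \<in> N" for A using e that by (simp add: g_def)
  have gemap: "map (map_sum g id) (map (map_sum e id) w) = w" if "w \<in> lists (N <+> T)" for w
    using that ge by (induction w) auto
  let ?P = "rename_productions e P"
  define H :: "(nat, 't, unit) valence_grammar" where
    "H = \<lparr>nonterminals = e ` N, terminals = T, productions = ?P, start = e S\<rparr>"
  have "rename_productions g ?P = P"
  proof -
    have "(\<lambda>(A, w, c). (g A, map (map_sum g id) w, c)) ((\<lambda>(A, w, c). (e A, map (map_sum e id) w, c)) p) = p"
      if "p \<in> P" for p
    proof -
      obtain A w c where p: "p = (A, w, c)" by (cases p)
      then have "A \<in> N" "w \<in> lists (N <+> T)" using that assms(4) by auto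
      then show ?thesis using ge gemap p by (simp del: map_map)
    qed
    then show ?thesis unfolding rename_productions_def image_image by simp
  qed
  then have iff: "derives P [Inl S] ws x \<longleftrightarrow> derives ?P [Inl (e S)] ws x" for ws x
    using derives_rename[of P "[Inl S]" ws x e] derives_rename[of ?P "[Inl (e S)]" ws x g] ge assms(5)
    by auto
  have lists: "map (map_sum e id) w \<in> lists (e ` N <+> T)" if "w \<in> lists (N <+> T)" for w
    using that by (induction w) auto
  then have "?P \<subseteq> e ` N \<times> lists (e ` N <+> T) \<times> {()}"
    using assms(4) unfolding rename_productions_def by auto
  then have H: "valence_grammar_over (singleton_group ()) H"
    using assms by (simp add: valence_grammar_over_def H_def sentential_forms_def singleton_group_def
      rename_productions_def)
  have "monoid (singleton_group ())" by (simp add: group.is_monoid)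
  from generated_language_eq[OF this H] have
    "generated_language (singleton_group ()) H = {x. \<exists>ws. derives P [Inl S] ws x}"
    by (simp add: H_def iff)
  then show ?thesis using H unfolding context_free_def by metis
qed

text \<open>The nonterminal \<open>(u, v)\<close> is meant to generate the words \<open>x\<close>
  with \<open>block_derives M P V u v x\<close>; the three families mirror the rules of
  \<open>block_derives\<close>.\<close>

definition block_productions ::
    "('m, 'b) monoid_scheme \<Rightarrow> ('n \<times> ('n + 't) list \<times> 'm) set \<Rightarrow>
     ((('n + 't) list \<times> 'm list) \<times> ((('n + 't) list \<times> 'm list) + 't) list \<times> unit) set" where
  "block_productions M P = {(([], []), [], ())} \<union>
     {((Inr a # u, v), [Inr a, Inl (u, v)], ()) | a u v. True} \<union>
     {((Inl A # u, v), [Inl (w, v1), Inl (u, v2)], ()) | A u v w c v1 v2.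
        (A, w, c) \<in> P \<and> root_merges M c v1 v2 v}"

lemma derives_start_production:
  fixes P :: "('n \<times> ('n + 't) list \<times> unit) set"
  assumes "(q, r, ()) \<in> P" "derives P r ws x"
  shows "derives P [Inl q] (() # ws) x"
  using derives.Nonterminal[OF assms derives.Nil] by simp

lemma derives_single_append:
  assumes "derives P [Inl q1] ws1 x1" "derives P [Inl q2] ws2 x2"
  shows "\<exists>ws. derives P [Inl q1, Inl q2] ws (x1 @ x2)"
proof -
  have "ws1 @ ws2 \<in> shuffles ws1 ws2" using shuffles_append_left[of ws2 "[]" ws2 ws1] by simp
  then show ?thesis using derives_append[OF assms] by auto
qed

text \<open>The rules only remove the head of a form or pass to a right-hand side. Hence suffixes of
  right-hand sides and of the start form suffice, and with \<open>V\<close> finite there are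
  finitely many nonterminals.\<close>

lemma context_free_block_derives:
  fixes P :: "('n \<times> ('n + 't) list \<times> 'm) set"
  assumes "finite P" "finite T" "P \<subseteq> N \<times> lists (N <+> T) \<times> C" "S \<in> N"
    and V: "finite V" "[] \<in> V" "v0 \<in> V"
  shows "context_free {x. block_derives M P V [Inl S] v0 x}"
proof -
  define U where "U = (\<Union>u \<in> insert [Inl S] ((fst \<circ> snd) ` P). set (suffixes u))"
  have finU: "finite U" using assms(1) by (simp add: U_def)
  have U_P: "w \<in> U" if "(A, w, c) \<in> P" for A w c
    using that unfolding U_def by (force simp: in_set_suffixes)
  have U_S: "[Inl S] \<in> U" by (simp add: U_def)
  have U_tl: "u \<in> U" if "X # u \<in> U" for X u
  proof -
    have "suffix u w" if "suffix (X # u) w" for w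
      using that by (rule suffix_ConsD)
    then show ?thesis using that unfolding U_def by (auto simp: in_set_suffixes simp del: suffixes.simps)
  qed
  define Q where "Q = U \<times> V"
  \<comment> \<open>Right-hand sides in \<open>block_productions\<close> have at most two symbols;
    making this bound explicit yields finiteness of \<open>R\<close>.\<close>
  define R where "R = block_productions M P \<inter> Q \<times> {r \<in> lists (Q <+> T). length r \<le> 2} \<times> UNIV"
  have finQ: "finite Q" using finU V(1) by (simp add: Q_def)
  have U_T: "a \<in> T" if au: "Inr a # u \<in> U" for a u
  proof -
    obtain w where w: "w \<in> insert [Inl S] ((fst \<circ> snd) ` P)" "suffix (Inr a # u) w"
      using au unfolding U_def UN_iff in_set_suffixes by blast
    then have "w \<in> lists (N <+> T)" using assms(3,4) by fastforce
    moreover have "Inr a \<in> set w" using set_mono_suffix[OF w(2)] by auto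
    ultimately show ?thesis by auto
  qed
  have complete: "\<exists>ws. derives R [Inl (u, v)] ws x" if "block_derives M P V u v x" "u \<in> U" for u v x
    using that
  proof (induction rule: block_derives.induct)
    case Nil
    then have "(([], []), [], ()) \<in> R"
      using V(2) by (simp add: R_def Q_def block_productions_def)
    from derives_start_production[OF this derives.Nil] show ?case by blast
  next
    case (Terminal u v x a)
    have u: "u \<in> U" "a \<in> T" using Terminal.prems U_tl U_T by blast+
    have v: "v \<in> V" using block_derives_in[OF Terminal.hyps V(2)] .
    have R: "((Inr a # u, v), [Inr a, Inl (u, v)], ()) \<in> R"
      using u v Terminal.prems by (auto simp: R_def Q_def block_productions_def)
    obtain ws where "derives R [Inl (u, v)] ws x" using Terminal.IH[OF u(1)] by blast
    from derives_start_production[OF R derives.Terminal[OF this]] show ?case by blast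
  next
    case (Nonterminal A w c v1 x1 u v2 x2 v)
    have u: "u \<in> U" "w \<in> U" using Nonterminal.prems U_tl U_P[OF Nonterminal.hyps(1)] by blast+
    have v: "v1 \<in> V" "v2 \<in> V"
      using block_derives_in[OF Nonterminal.hyps(2) V(2)] block_derives_in[OF Nonterminal.hyps(3) V(2)] .
    have "((Inl A # u, v), [Inl (w, v1), Inl (u, v2)], ()) \<in> block_productions M P"
      using Nonterminal.hyps(1,4) unfolding block_productions_def by blast
    then have R: "((Inl A # u, v), [Inl (w, v1), Inl (u, v2)], ()) \<in> R"
      using u v Nonterminal.prems Nonterminal.hyps(5) by (auto simp: R_def Q_def)
    obtain ws1 ws2 where "derives R [Inl (w, v1)] ws1 x1" "derives R [Inl (u, v2)] ws2 x2"
      using Nonterminal.IH(1)[OF u(2)] Nonterminal.IH(2)[OF u(1)] by blast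
    from derives_single_append[OF this]
    obtain ws where "derives R [Inl (w, v1), Inl (u, v2)] ws (x1 @ x2)" ..
    from derives_start_production[OF R this] show ?case by blast
  qed
  \<comment> \<open>The words that a symbol is meant to generate; soundness is shown for whole
    forms, symbol by symbol.\<close>
  define sem where "sem X y = (case X of Inl (u, v) \<Rightarrow> block_derives M P V u v y | Inr a \<Rightarrow> y = [a])"
    for X y
  have sem_simps: "sem (Inl (u, v)) y \<longleftrightarrow> block_derives M P V u v y" "sem (Inr a) y \<longleftrightarrow> y = [a]"
    for u v y a by (simp_all add: sem_def)
  have sound: "\<exists>ys. list_all2 sem r ys \<and> x = concat ys" if "derives R r ws x" for r ws x
    using that
  proof (induction rule: derives.induct)
    case Nil
    show ?case by (intro exI[of _ "[]"]) simp
  next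
    case (Terminal u ws x a)
    then obtain ys where "list_all2 sem u ys" "x = concat ys" by blast
    then show ?case by (intro exI[of _ "[a] # ys"]) (simp add: sem_simps)
  next
    case (Nonterminal q r c ws1 x1 u ws2 x2 ws)
    obtain ys zs where ys: "list_all2 sem r ys" "x1 = concat ys" and zs: "list_all2 sem u zs" "x2 = concat zs"
      using Nonterminal.IH by blast
    have q: "(q, r, c) \<in> block_productions M P" "q \<in> Q"
      using Nonterminal.hyps(1) by (auto simp: R_def)
    from q(1) consider "q = ([], [])" "r = []"
      | a u v where "q = (Inr a # u, v)" "r = [Inr a, Inl (u, v)]"
      | A u v w c v1 v2 where "q = (Inl A # u, v)" "r = [Inl (w, v1), Inl (u, v2)]"
          "(A, w, c) \<in> P" "root_merges M c v1 v2 v"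
      unfolding block_productions_def by blast
    then have "sem (Inl q) x1"
    proof cases
      case 1
      then show ?thesis using ys by (simp add: sem_simps block_derives.Nil)
    next
      case (2 a u v)
      then show ?thesis using ys by (auto simp: sem_simps list_all2_Cons1 block_derives.Terminal)
    next
      case (3 A u v w c v1 v2)
      then obtain y1 y2 where "block_derives M P V w v1 y1" "block_derives M P V u v2 y2" "x1 = y1 @ y2"
        using ys by (auto simp: sem_simps list_all2_Cons1)
      \<comment> \<open>Membership of \<open>q\<close> in \<open>Q\<close> supplies
        \<open>v \<in> V\<close>.\<close>
      then show ?thesis
        using block_derives.Nonterminal[OF 3(3) _ _ 3(4)] 3(1) q(2) by (simp add: sem_simps Q_def)
    qed
    then show ?case using zs by (intro exI[of _ "x1 # zs"]) simp
  qed
  have "{x. \<exists>ws. derives R [Inl ([Inl S], v0)] ws x} = {x. block_derives M P V [Inl S] v0 x}"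
  proof (intro Set.set_eqI iffI)
    fix x assume "x \<in> {x. \<exists>ws. derives R [Inl ([Inl S], v0)] ws x}"
    then obtain ys where "list_all2 sem [Inl ([Inl S], v0)] ys" "x = concat ys" using sound by blast
    then show "x \<in> {x. block_derives M P V [Inl S] v0 x}" by (auto simp: sem_simps list_all2_Cons1)
  next
    fix x assume "x \<in> {x. block_derives M P V [Inl S] v0 x}"
    then show "x \<in> {x. \<exists>ws. derives R [Inl ([Inl S], v0)] ws x}" using complete U_S by simp
  qed
  moreover have "finite R"
  proof (rule finite_subset)
    show "R \<subseteq> Q \<times> {r. set r \<subseteq> Q <+> T \<and> length r \<le> 2} \<times> UNIV" unfolding R_def by auto
    show "finite (Q \<times> {r. set r \<subseteq> Q <+> T \<and> length r \<le> 2} \<times> (UNIV :: unit set))"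
      using finQ assms(2) by (intro finite_cartesian_product finite_lists_length_le finite_Plus) auto
  qed
  moreover have "R \<subseteq> Q \<times> lists (Q <+> T) \<times> UNIV" unfolding R_def by blast
  moreover have "([Inl S], v0) \<in> Q" using U_S V(3) by (simp add: Q_def)
  ultimately show ?thesis using context_freeI[OF finQ assms(2)] by metis
qed

section \<open>Right-invertible elements\<close>

lemma generated_submonoid_subset: "F \<subseteq> generated_submonoid M F"
  by (auto simp: generated_submonoid_def)

lemma (in monoid) generated_submonoid_submonoid:
  assumes "F \<subseteq> carrier G"
  shows "submonoid (generated_submonoid G F) G"
proof
  have "submonoid (carrier G) G" by standard auto
  then show "generated_submonoid G F \<subseteq> carrier G"
    using assms by (auto simp: generated_submonoid_def)
next
  show "x \<otimes> y \<in> generated_submonoid G F"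
    if "x \<in> generated_submonoid G F" "y \<in> generated_submonoid G F" for x y
    using that by (auto simp: generated_submonoid_def submonoid.m_closed)
next
  show "\<one> \<in> generated_submonoid G F"
    by (auto simp: generated_submonoid_def submonoid.one_closed)
qed

text \<open>
  Right multiplication by a right-invertible element is injective, hence by finiteness surjective,
  which yields left inverses.
\<close>

lemma (in monoid) group_right_invertibles:
  assumes "finite (right_invertibles G)"
  shows "group (G\<lparr>carrier := right_invertibles G\<rparr>)"
proof (rule groupI; simp)
  let ?R = "right_invertibles G"
  have R: "a \<in> carrier G" if "a \<in> ?R" for a using that by (simp add: right_invertibles_def)
  show closed: "a \<otimes> b \<in> ?R" if ab: "a \<in> ?R" "b \<in> ?R" for a b
  proof -
    obtain a' b' where inv: "a' \<in> carrier G" "a \<otimes> a' = \<one>" "b' \<in> carrier G" "b \<otimes> b' = \<one>"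
      using ab by (auto simp: right_invertibles_def)
    have "b \<otimes> (b' \<otimes> a') = a'"
      using R ab inv by (simp flip: m_assoc)
    then have "a \<otimes> b \<otimes> (b' \<otimes> a') = \<one>" using R ab inv by (simp add: m_assoc)
    then show ?thesis using R ab inv unfolding right_invertibles_def by blast
  qed
  show "\<one> \<in> ?R" by (auto simp: right_invertibles_def)
  show "a \<otimes> b \<otimes> c = a \<otimes> (b \<otimes> c)" if "a \<in> ?R" "b \<in> ?R" "c \<in> ?R" for a b c
    using that R by (simp add: m_assoc)
  show "\<one> \<otimes> a = a" if "a \<in> ?R" for a using that R by simp
  show "\<exists>b \<in> ?R. b \<otimes> a = \<one>" if a: "a \<in> ?R" for a
  proof -
    obtain a' where a': "a' \<in> carrier G" "a \<otimes> a' = \<one>" using a by (auto simp: right_invertibles_def)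
    have "inj_on (\<lambda>x. x \<otimes> a) ?R"
    proof
      fix x y assume xy: "x \<in> ?R" "y \<in> ?R" "x \<otimes> a = y \<otimes> a"
      then have "x \<otimes> a \<otimes> a' = y \<otimes> a \<otimes> a'" by simp
      then show "x = y" using R xy(1,2) a a' by (simp add: m_assoc)
    qed
    moreover have "(\<lambda>x. x \<otimes> a) ` ?R \<subseteq> ?R" using closed a by blast
    ultimately have "(\<lambda>x. x \<otimes> a) ` ?R = ?R" using assms by (intro endo_inj_surj) auto
    then show ?thesis using \<open>\<one> \<in> ?R\<close> by (metis imageE)
  qed
qed

text \<open>The first factor of a right-invertible product is right-invertible, hence has a left
  inverse \<open>d\<close> in the group. Multiplying by \<open>d\<close> shows the remaining product
  to be right-invertible.\<close>

lemma (in monoid) factors_right_invertible: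
  assumes "finite (right_invertibles G)" "set ws \<subseteq> carrier G" "word_prod G ws \<in> right_invertibles G"
  shows "set ws \<subseteq> right_invertibles G"
  using assms(2,3)
proof (induction ws)
  case (Cons c ws)
  let ?R = "right_invertibles G"
  interpret R: group "G\<lparr>carrier := ?R\<rparr>" using group_right_invertibles[OF assms(1)] .
  have car: "c \<in> carrier G" "word_prod G ws \<in> carrier G" using Cons.prems by auto
  obtain b where "b \<in> carrier G" "c \<otimes> word_prod G ws \<otimes> b = \<one>"
    using Cons.prems(2) by (auto simp: right_invertibles_def)
  then have "c \<otimes> (word_prod G ws \<otimes> b) = \<one>" using car by (simp add: m_assoc)
  then have c: "c \<in> ?R" using car \<open>b \<in> carrier G\<close> by (auto simp: right_invertibles_def)
  then obtain d where d: "d \<in> ?R" "d \<otimes> c = \<one>"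
    using R.l_inv_ex by auto
  have "d \<otimes> (c \<otimes> word_prod G ws) \<in> ?R"
    using R.m_closed[of d "c \<otimes> word_prod G ws"] d(1) Cons.prems(2) by simp
  moreover have "d \<in> carrier G" using d(1) by (simp add: right_invertibles_def)
  ultimately have "word_prod G ws \<in> ?R"
    using d car by (simp flip: m_assoc)
  then show ?case using Cons c by simp
qed simp

section \<open>Reduction to a finite group\<close>

theorem lemma9:
  fixes M :: "('m, 'b) monoid_scheme"
    and G :: "('n, 't, 'm) valence_grammar"
  assumes "monoid M"
    and "\<And>K. fin_gen_submonoid K M \<Longrightarrow> finite (right_invertibles (M\<lparr>carrier := K\<rparr>))"
    and "valence_grammar_over M G"
  shows "context_free (generated_language M G)"
proof -
  interpret M: monoid M by fact
  define P where "P = productions G"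
  define N where "N = nonterminals G"
  define T where "T = terminals G"
  define S where "S = start G"
  have G: "finite P" "finite T" "P \<subseteq> N \<times> lists (N <+> T) \<times> carrier M" "S \<in> N"
    using assms(3) by (auto simp: valence_grammar_over_def sentential_forms_def P_def N_def T_def S_def)
  define F where "F = (snd \<circ> snd) ` P"
  define K where "K = M\<lparr>carrier := generated_submonoid M F\<rparr>"
  have F: "finite F" "F \<subseteq> carrier M" using G(1,3) by (auto simp: F_def)
  have FK: "F \<subseteq> carrier K" using generated_submonoid_subset[of F M] by (simp add: K_def)
  interpret K: monoid K
    unfolding K_def by (rule submonoid.submonoid_is_monoid[OF M.generated_submonoid_submonoid[OF F(2)] assms(1)])
  have fin: "finite (right_invertibles K)"
    using assms(2) F unfolding K_def fin_gen_submonoid_def by blast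
  define H where "H = K\<lparr>carrier := right_invertibles K\<rparr>"
  interpret H: group H unfolding H_def by (rule K.group_right_invertibles[OF fin])
  have finH: "finite (carrier H)" using fin by (simp add: H_def)
  have prod: "word_prod M ws = word_prod H ws" "word_prod K ws = word_prod H ws" for ws
    by (simp_all add: H_def K_def)
  have one: "\<one>\<^bsub>M\<^esub> = \<one>\<^bsub>H\<^esub>" "\<one>\<^bsub>K\<^esub> = \<one>\<^bsub>H\<^esub>" by (simp_all add: H_def K_def)
  \<comment> \<open>By \<open>factors_right_invertible\<close>, labels outside \<open>H\<close>
    cannot occur in a label word with product \<open>\<one>\<close>. Dropping their productions puts
    all labels into a finite group.\<close>
  define P' where "P' = {(A, w, c) \<in> P. c \<in> carrier H}"
  have P': "P' \<subseteq> P" "(snd \<circ> snd) ` P' \<subseteq> carrier H" by (auto simp: P'_def)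
  define V where "V = {v. set v \<subseteq> carrier H \<and> length v \<le> 2 * card (carrier H) ^ 3}"
  \<comment> \<open>This makes the length bound at least 1, which admits the one-entry annotation of
    a whole derivation.\<close>
  have "card (carrier H) > 0" using finH H.one_closed card_gt_0_iff by blast
  then have V: "finite V" "[] \<in> V" "[\<one>\<^bsub>H\<^esub>] \<in> V"
    using finite_lists_length_le[OF finH] by (simp_all add: V_def Suc_le_eq)
  have "generated_language M G = {x. block_derives H P' V [Inl S] [\<one>\<^bsub>H\<^esub>] x}"
  proof (intro Set.set_eqI iffI)
    fix x assume "x \<in> generated_language M G"
    then obtain ws where ws: "derives P [Inl S] ws x" "word_prod H ws = \<one>\<^bsub>H\<^esub>"
      using generated_language_eq[OF assms(1,3)] unfolding P_def S_def prod one by blast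
    have "set ws \<subseteq> carrier K" using derives_labels[OF ws(1)] FK unfolding F_def by blast
    moreover have "word_prod K ws \<in> right_invertibles K"
      using H.one_closed unfolding prod ws(2) by (simp add: H_def)
    ultimately have "set ws \<subseteq> carrier H"
      using K.factors_right_invertible[OF fin] by (simp add: H_def)
    from derives_restrict_labels[OF ws(1) this]
    have "derives P' [Inl S] ws x" unfolding P'_def .
    from H.block_derives_complete[OF finH P'(2) this]
    show "x \<in> {x. block_derives H P' V [Inl S] [\<one>\<^bsub>H\<^esub>] x}" unfolding ws(2) V_def by simp
  next
    fix x assume "x \<in> {x. block_derives H P' V [Inl S] [\<one>\<^bsub>H\<^esub>] x}"
    then have "block_derives H P' V [Inl S] [\<one>\<^bsub>H\<^esub>] x" by simp
    from H.derives_if_block_derives[OF this P'(2)]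
    obtain wss where "map (word_prod H) wss = [\<one>\<^bsub>H\<^esub>]" "derives P' [Inl S] (concat wss) x"
      by (elim exE conjE)
    \<comment> \<open>The top annotation has one entry, so \<open>wss\<close> is a single
      word.\<close>
    then obtain ws where ws: "word_prod H ws = \<one>\<^bsub>H\<^esub>" "derives P' [Inl S] ws x" by auto
    have "derives P [Inl S] ws x" using derives_mono[OF ws(2) P'(1)] .
    then show "x \<in> generated_language M G"
      using ws(1) generated_language_eq[OF assms(1,3)] unfolding P_def S_def prod one by blast
  qed
  moreover have "context_free {x. block_derives H P' V [Inl S] [\<one>\<^bsub>H\<^esub>] x}"
    using G P' V by (intro context_free_block_derives[of P' T N "carrier M" S]) (auto intro: finite_subset)
  ultimately show ?thesis by simp
qed

end
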